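(* Let $H=\Bbbk^{\mathbb{Z}_2}{}^\tau\#_{\sigma}\Bbbk F$. Then the Grothendieck ring $\operatorname{Gr}(H\text{-comod})$ of the category of finite-dimensional right $H$-comodules is determined by the following isomorphisms: for all $f,f'\in S$: $\tilde U_f\otimes\tilde U_{f'}\cong\tilde V_f\otimes\tilde V_{f'}\cong\tilde U_{ff'}$ and $\tilde U_f\otimes\tilde V_{f'}\cong\tilde V_f\otimes\tilde U_{f'}\cong\tilde V_{ff'}$; for all $f\in S$, $f'\in T$: $\tilde U_f\otimes\tilde W_{f'}\cong\tilde V_f\otimes\tilde W_{f'}\cong\tilde W_{ff'}$ and $\tilde W_{f'}\otimes\tilde U_f\cong\tilde W_{f'}\otimes\tilde V_f\cong\tilde W_{f'f}$; for all $f,f'\in T$: $$\tilde W_f\otimes\tilde W_{f'}\cong\begin{cases}\tilde W_{ff'}\oplus\tilde W_{f(g\triangleright f')}, & ff',\,f(g\triangleright f')\in T;\\ \tilde U_{ff'}\oplus\tilde V_{ff'}\oplus\tilde W_{f(g\triangleright f')}, & ff'\in S,\ f(g\triangleright f')\in T;\\ \tilde W_{ff'}\oplus\tilde U_{f(g\triangleright f')}\oplus\tilde V_{f(g\triangleright f')}, & ff'\in T,\ f(g\triangleright f')\in S;\\ \tilde U_{ff'}\oplus\tilde V_{ff'}\oplus\tilde U_{f(g\triangleright f')}\oplus\tilde V_{f(g\triangleright f')}, & ff',\,f(g\triangleright f')\in S.\end{cases}$$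
   Context: $\Bbbk$ is an algebraically closed field of characteristic zero, $G=\mathbb{Z}_2=\langle g\mid g^2=1\rangle$ and $F$ is an arbitrary group. $(F,G,\triangleleft,\triangleright)$ is a matched pair of groups: $\triangleleft:G\times F\to G$ is a right action of $F$ on the set $G$ and $\triangleright:G\times F\to F$ is a left action of $G$ on the set $F$, such that $a\triangleright(ff')=(a\triangleright f)((a\triangleleft f)\triangleright f')$ and $(ab)\triangleleft f=(a\triangleleft(b\triangleright f))(b\triangleleft f)$ for all $a,b\in G$, $f,f'\in F$. (For $G=\mathbb{Z}_2$ the action $\triangleleft$ is necessarily trivial.) The maps $\sigma:G\times F\times F\to\Bbbk^\times$ and $\tau:G\times G\times F\to\Bbbk^\times$ satisfy, for all $a,b,c\in G$, $f,f',f''\in F$: $\sigma(a;1_F,f)=\sigma(a;f,1_F)=\sigma(1_G;f,f')=1$; $\sigma(a\triangleleft f;f',f'')\sigma(a;f,f'f'')=\sigma(a;f,f')\sigma(a;ff',f'')$; $\tau(1_G,a;f)=\tau(a,1_G;f)=\tau(a,b;1_F)=1$; $\tau(a,b;c\triangleright f)\tau(ab,c;f)=\tau(a,bc;f)\tau(b,c;f)$; $\sigma(ab;f,f')\tau(a,b;ff')=\sigma(a;b\triangleright f,(b\triangleleft f)\triangleright f')\,\sigma(b;f,f')\,\tau(a,b;f)\,\tau(a\triangleleft(b\triangleright f),b\triangleleft f;f')$. The Hopf algebra $\Bbbk^G{}^\tau\#_{\sigma}\Bbbk F$ is the vector space $\Bbbk^G\otimes\Bbbk F$ with basis $p_a\#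 f:=p_a\otimes f$ ($a\in G,f\in F$; $\{p_a\}$ is the basis of $\Bbbk^G$ dual to $G\subset\Bbbk G$), multiplication $(p_a\# f)(p_{b}\# f')=\delta_{a\triangleleft f,b}\sigma(a;f,f')\,p_a\# ff'$, comultiplication $\Delta(p_a\# f)=\sum_{x\in G}\tau(ax^{-1},x;f)\,(p_{ax^{-1}}\#(x\triangleright f))\otimes(p_x\# f)$, unit $\sum_{a\in G}p_a\#1_F$ and counit $\varepsilon(p_a\# f)=\delta_{a,1_G}$. It is cosemisimple. $S=\{f\in F\mid g\triangleright f=f\}$ and $T=\{f\in F\mid g\triangleright f\neq f\}$. The character of a finite-dimensional right $H$-comodule $(M,\rho)$ with basis $m_i$ and dual basis $m_i^*$ is $\chi(M)=\sum_i(m_i^*\otimes\operatorname{id})\rho(m_i)\in H$; it determines $M$ up to isomorphism. Up to isomorphism, the simple right $H$-comodules are $\tilde U_f,\tilde V_f$ ($f\in S$) and $\tilde W_f$ ($f\in T$), with $\tilde W_f\cong\tilde W_{g\triangleright f}$, determined by their characters $\chi(\tilde U_f)=p_1\#f+\sqrt{\tau(g,g;f)}\,p_g\#f$, $\chi(\tilde V_f)=p_1\#f-\sqrt{\tau(g,g;f)}\,p_g\#f$ ($f\in S$), $\chi(\tilde W_f)=p_1\#f+p_1\#(g\triangleright f)$ ($f\in T$), where $\sqrt{\tau(g,g;f)}$ denotes a square root of $\tau(g,g;f)$ in $\Bbbk$ for each $f\in S$. The Grothendieck ring $\operatorname{Gr}(H\text{-comod})$ has the isomorphism classes of simple right $H$-comodules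 as $\mathbb{Z}$-basis and multiplication induced by $\otimes$.
   Formalization: For f,f' in S the printed products are stated when √τ(g,g;ff') = σ(g;f,f')√τ(g,g;f)√τ(g,g;f'); otherwise U_{ff'} and V_{ff'} are exchanged. As printed they fail, e.g. F={1,h}, trivial actions, τ=1, σ(g;h,h)=-1. *)

theory Defs
  imports
    "HOL-Algebra.Group"
    "HOL-Analysis.Cartesian_Space"
    "HOL-Computational_Algebra.Polynomial"
    "HOL-Library.Poly_Mapping"
begin

text \<open>
  Throughout, \<open>ra a f\<close> stands for the right action \<open>a \<triangleleft> f\<close> of \<open>F\<close> on the set \<open>G\<close>, and
  \<open>la a f\<close> for the left action \<open>a \<triangleright> f\<close> of \<open>G\<close> on the set \<open>F\<close>.
\<close>

definition matched_pair ::
  "('b, 'n) monoid_scheme \<Rightarrow> ('a, 'm) monoid_scheme \<Rightarrow>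
   ('a \<Rightarrow> 'b \<Rightarrow> 'a) \<Rightarrow> ('a \<Rightarrow> 'b \<Rightarrow> 'b) \<Rightarrow> bool" where
  "matched_pair F G ra la \<longleftrightarrow>
     group F \<and> group G \<and>
     (\<forall>a\<in>carrier G. \<forall>f\<in>carrier F. ra a f \<in> carrier G \<and> la a f \<in> carrier F) \<and>
     (\<forall>a\<in>carrier G. ra a \<one>\<^bsub>F\<^esub> = a) \<and>
     (\<forall>a\<in>carrier G. \<forall>f\<in>carrier F. \<forall>f'\<in>carrier F. ra a (f \<otimes>\<^bsub>F\<^esub> f') = ra (ra a f) f') \<and>
     (\<forall>f\<in>carrier F. la \<one>\<^bsub>G\<^esub> f = f) \<and>
     (\<forall>a\<in>carrier G. \<forall>b\<in>carrier G. \<forall>f\<in>carrier F. la (a \<otimes>\<^bsub>G\<^esub> b) f = la a (la b f)) \<and>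
     (\<forall>a\<in>carrier G. \<forall>f\<in>carrier F. \<forall>f'\<in>carrier F.
        la a (f \<otimes>\<^bsub>F\<^esub> f') = la a f \<otimes>\<^bsub>F\<^esub> la (ra a f) f') \<and>
     (\<forall>a\<in>carrier G. \<forall>b\<in>carrier G. \<forall>f\<in>carrier F.
        ra (a \<otimes>\<^bsub>G\<^esub> b) f = ra a (la b f) \<otimes>\<^bsub>G\<^esub> ra b f)"

text \<open>Here \<open>\<sigma> a f f'\<close> is \<open>\<sigma>(a; f, f')\<close> and \<open>\<tau> a b f\<close> is \<open>\<tau>(a, b; f)\<close>.\<close>

definition compatible_cocycles ::
  "('b, 'n) monoid_scheme \<Rightarrow> ('a, 'm) monoid_scheme \<Rightarrow>
   ('a \<Rightarrow> 'b \<Rightarrow> 'a) \<Rightarrow> ('a \<Rightarrow> 'b \<Rightarrow> 'b) \<Rightarrow>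
   ('a \<Rightarrow> 'b \<Rightarrow> 'b \<Rightarrow> 'k::field) \<Rightarrow> ('a \<Rightarrow> 'a \<Rightarrow> 'b \<Rightarrow> 'k) \<Rightarrow> bool" where
  "compatible_cocycles F G ra la \<sigma> \<tau> \<longleftrightarrow>
     (\<forall>a\<in>carrier G. \<forall>f\<in>carrier F. \<forall>f'\<in>carrier F. \<sigma> a f f' \<noteq> 0) \<and>
     (\<forall>a\<in>carrier G. \<forall>b\<in>carrier G. \<forall>f\<in>carrier F. \<tau> a b f \<noteq> 0) \<and>
     (\<forall>a\<in>carrier G. \<forall>f\<in>carrier F. \<sigma> a \<one>\<^bsub>F\<^esub> f = 1 \<and> \<sigma> a f \<one>\<^bsub>F\<^esub> = 1) \<and>
     (\<forall>f\<in>carrier F. \<forall>f'\<in>carrier F. \<sigma> \<one>\<^bsub>G\<^esub> f f' = 1) \<and>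
     (\<forall>a\<in>carrier G. \<forall>f\<in>carrier F. \<forall>f'\<in>carrier F. \<forall>f''\<in>carrier F.
        \<sigma> (ra a f) f' f'' * \<sigma> a f (f' \<otimes>\<^bsub>F\<^esub> f'') = \<sigma> a f f' * \<sigma> a (f \<otimes>\<^bsub>F\<^esub> f') f'') \<and>
     (\<forall>a\<in>carrier G. \<forall>f\<in>carrier F. \<tau> \<one>\<^bsub>G\<^esub> a f = 1 \<and> \<tau> a \<one>\<^bsub>G\<^esub> f = 1) \<and>
     (\<forall>a\<in>carrier G. \<forall>b\<in>carrier G. \<tau> a b \<one>\<^bsub>F\<^esub> = 1) \<and>
     (\<forall>a\<in>carrier G. \<forall>b\<in>carrier G. \<forall>c\<in>carrier G. \<forall>f\<in>carrier F.
        \<tau> a b (la c f) * \<tau> (a \<otimes>\<^bsub>G\<^esub> b) c f = \<tau> a (b \<otimes>\<^bsub>G\<^esub> c) f * \<tau> b c f) \<and>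
     (\<forall>a\<in>carrier G. \<forall>b\<in>carrier G. \<forall>f\<in>carrier F. \<forall>f'\<in>carrier F.
        \<sigma> (a \<otimes>\<^bsub>G\<^esub> b) f f' * \<tau> a b (f \<otimes>\<^bsub>F\<^esub> f') =
        \<sigma> a (la b f) (la (ra b f) f') * \<sigma> b f f' * \<tau> a b f * \<tau> (ra a (la b f)) (ra b f) f')"

text \<open>
  A vector space with basis \<open>B\<close> is represented by the finitely supported functions on \<open>B\<close>.
  In particular the underlying space of \<open>H = k\<^sup>G \<^sup>\<tau>#\<^sub>\<sigma> kF\<close> consists of the finitely supported
  functions on pairs \<open>(a, f)\<close>, with support in \<open>carrier G \<times> carrier F\<close>; the basis
  element \<open>p\<^sub>a # f\<close> is \<open>hbasis a f\<close>.
\<close>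

type_synonym ('a, 'b, 'k) hopf = "('a \<times> 'b) \<Rightarrow>\<^sub>0 'k"

definition smul :: "'k::field \<Rightarrow> ('s \<Rightarrow>\<^sub>0 'k) \<Rightarrow> ('s \<Rightarrow>\<^sub>0 'k)" where
  "smul c x = Poly_Mapping.map ((*) c) x"

definition lin_extend :: "('s \<Rightarrow> ('t \<Rightarrow>\<^sub>0 'k::field)) \<Rightarrow> ('s \<Rightarrow>\<^sub>0 'k) \<Rightarrow> ('t \<Rightarrow>\<^sub>0 'k)" where
  "lin_extend \<phi> x = (\<Sum>s\<in>Poly_Mapping.keys x. smul (Poly_Mapping.lookup x s) (\<phi> s))"

text \<open>The element \<open>x \<otimes> y\<close> of the tensor product of two spaces with bases.\<close>

definition tensor_elt :: "('s \<Rightarrow>\<^sub>0 'k::field) \<Rightarrow> ('t \<Rightarrow>\<^sub>0 'k) \<Rightarrow> (('s \<times> 't) \<Rightarrow>\<^sub>0 'k)" where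
  "tensor_elt x y = lin_extend (\<lambda>s. lin_extend (\<lambda>t. Poly_Mapping.single (s, t) 1) y) x"

definition hcarrier ::
  "('b, 'n) monoid_scheme \<Rightarrow> ('a, 'm) monoid_scheme \<Rightarrow> ('a, 'b, 'k::field) hopf set" where
  "hcarrier F G = {x. Poly_Mapping.keys x \<subseteq> carrier G \<times> carrier F}"

definition hbasis :: "'a \<Rightarrow> 'b \<Rightarrow> ('a, 'b, 'k::field) hopf" where
  "hbasis a f = Poly_Mapping.single (a, f) 1"

definition hmult ::
  "('b, 'n) monoid_scheme \<Rightarrow> ('a \<Rightarrow> 'b \<Rightarrow> 'a) \<Rightarrow> ('a \<Rightarrow> 'b \<Rightarrow> 'b \<Rightarrow> 'k) \<Rightarrow>
   ('a, 'b, 'k::field) hopf \<Rightarrow> ('a, 'b, 'k) hopf \<Rightarrow> ('a, 'b, 'k) hopf" where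
  "hmult F ra \<sigma> x y =
     lin_extend (\<lambda>(a, f). lin_extend (\<lambda>(b, f').
       if ra a f = b then smul (\<sigma> a f f') (hbasis a (f \<otimes>\<^bsub>F\<^esub> f')) else 0) y) x"

definition hcomult ::
  "('a, 'm) monoid_scheme \<Rightarrow> ('a \<Rightarrow> 'b \<Rightarrow> 'b) \<Rightarrow> ('a \<Rightarrow> 'a \<Rightarrow> 'b \<Rightarrow> 'k) \<Rightarrow>
   ('a, 'b, 'k::field) hopf \<Rightarrow> ((('a \<times> 'b) \<times> ('a \<times> 'b)) \<Rightarrow>\<^sub>0 'k)" where
  "hcomult G la \<tau> =
     lin_extend (\<lambda>(a, f). \<Sum>x\<in>carrier G.
       smul (\<tau> (a \<otimes>\<^bsub>G\<^esub> inv\<^bsub>G\<^esub> x) x f)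
         (tensor_elt (hbasis (a \<otimes>\<^bsub>G\<^esub> inv\<^bsub>G\<^esub> x) (la x f)) (hbasis x f)))"

definition hcounit :: "('a, 'm) monoid_scheme \<Rightarrow> ('a, 'b, 'k::field) hopf \<Rightarrow> 'k" where
  "hcounit G x =
     (\<Sum>(a, f)\<in>Poly_Mapping.keys x. Poly_Mapping.lookup x (a, f) * (if a = \<one>\<^bsub>G\<^esub> then 1 else 0))"

text \<open>
  A finite-dimensional right \<open>H\<close>-comodule \<open>(M, \<rho>)\<close> with a basis \<open>m\<^sub>i\<close> indexed by a finite type is
  given by the coordinates \<open>C i j\<close> of its coaction, \<open>\<rho>(m\<^sub>j) = \<Sum>\<^sub>i m\<^sub>i \<otimes> C i j\<close>.
  Comparing coefficients of \<open>m\<^sub>i\<close>, coassociativity and counitality of \<open>\<rho>\<close> are the two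
  equations below.
\<close>

type_synonym ('i, 'a, 'b, 'k) coaction = "'i \<Rightarrow> 'i \<Rightarrow> ('a, 'b, 'k) hopf"

definition right_comodule ::
  "('b, 'n) monoid_scheme \<Rightarrow> ('a, 'm) monoid_scheme \<Rightarrow> ('a \<Rightarrow> 'b \<Rightarrow> 'b) \<Rightarrow>
   ('a \<Rightarrow> 'a \<Rightarrow> 'b \<Rightarrow> 'k) \<Rightarrow> ('i::finite, 'a, 'b, 'k::field) coaction \<Rightarrow> bool" where
  "right_comodule F G la \<tau> C \<longleftrightarrow>
     (\<forall>i j. C i j \<in> hcarrier F G) \<and>
     (\<forall>i j. hcomult G la \<tau> (C i j) = (\<Sum>k\<in>UNIV. tensor_elt (C i k) (C k j))) \<and>
     (\<forall>i j. hcounit G (C i j) = (if i = j then 1 else 0))"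

definition comod_character ::
  "('i::finite, 'a, 'b, 'k::field) coaction \<Rightarrow> ('a, 'b, 'k) hopf" where
  "comod_character C = (\<Sum>i\<in>UNIV. C i i)"

text \<open>
  The matrix \<open>P\<close> is that of a bijective linear map \<open>\<phi>(m\<^sub>i) = \<Sum>\<^sub>k P\<^sub>k\<^sub>i n\<^sub>k\<close>, and the equation is the
  coefficient of \<open>n\<^sub>k\<close> in \<open>(\<phi> \<otimes> id)(\<rho>(m\<^sub>j)) = \<rho>(\<phi>(m\<^sub>j))\<close>.
\<close>

definition comod_iso ::
  "('i::finite, 'a, 'b, 'k::field) coaction \<Rightarrow> ('j::finite, 'a, 'b, 'k) coaction \<Rightarrow> bool"
  (infix \<open>\<cong>\<^sub>c\<close> 50) where
  "C \<cong>\<^sub>c D \<longleftrightarrow>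
     (\<exists>P :: 'k ^ 'i ^ 'j. invertible P \<and>
        (\<forall>k j. (\<Sum>i\<in>UNIV. smul (P $ k $ i) (C i j)) = (\<Sum>l\<in>UNIV. smul (P $ l $ j) (D k l))))"

text \<open>The coaction \<open>m \<otimes> n \<mapsto> m\<^sub>0 \<otimes> n\<^sub>0 \<otimes> m\<^sub>1 n\<^sub>1\<close> in the basis \<open>m\<^sub>i \<otimes> n\<^sub>k\<close>.\<close>

definition comod_tensor ::
  "('b, 'n) monoid_scheme \<Rightarrow> ('a \<Rightarrow> 'b \<Rightarrow> 'a) \<Rightarrow> ('a \<Rightarrow> 'b \<Rightarrow> 'b \<Rightarrow> 'k) \<Rightarrow>
   ('i::finite, 'a, 'b, 'k::field) coaction \<Rightarrow> ('j::finite, 'a, 'b, 'k) coaction \<Rightarrow>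
   ('i \<times> 'j, 'a, 'b, 'k) coaction" where
  "comod_tensor F ra \<sigma> C D = (\<lambda>(i, k) (j, l). hmult F ra \<sigma> (C i j) (D k l))"

definition comod_sum ::
  "('i::finite, 'a, 'b, 'k::field) coaction \<Rightarrow> ('j::finite, 'a, 'b, 'k) coaction \<Rightarrow>
   ('i + 'j, 'a, 'b, 'k) coaction" (infixr \<open>\<oplus>\<^sub>c\<close> 65) where
  "C \<oplus>\<^sub>c D = (\<lambda>p q. case (p, q) of
      (Inl i, Inl j) \<Rightarrow> C i j
    | (Inr k, Inr l) \<Rightarrow> D k l
    | _ \<Rightarrow> 0)"

definition fixed_part :: "('b, 'n) monoid_scheme \<Rightarrow> ('a \<Rightarrow> 'b \<Rightarrow> 'b) \<Rightarrow> 'a \<Rightarrow> 'b set" where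
  "fixed_part F la g = {f \<in> carrier F. la g f = f}"

definition moved_part :: "('b, 'n) monoid_scheme \<Rightarrow> ('a \<Rightarrow> 'b \<Rightarrow> 'b) \<Rightarrow> 'a \<Rightarrow> 'b set" where
  "moved_part F la g = {f \<in> carrier F. la g f \<noteq> f}"

end

theory Submission
  imports Defs "HOL-Analysis.Determinants"
begin

text \<open>
  Dually, a right comodule \<open>M\<close> is a module over the twisted groupoid algebra \<open>H\<^sup>*\<close>. The
  functionals dual to the elements \<open>p\<^sub>1 # f\<close> act on \<open>M\<close> as orthogonal idempotents with sum \<open>1\<close>,
  so \<open>M\<close> is graded by \<open>F\<close>, and the functional dual to \<open>p\<^sub>g # f\<close> acts as a map
  \<open>M\<^sub>f \<rightarrow> M\<^bsub>g \<triangleright> f\<^esub>\<close> whose composition with the map back is the scalar \<open>\<tau>(g, g; f)\<close>. If \<open>f\<close> is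
  moved by \<open>g\<close>, the only invariant of the pair \<open>M\<^sub>f\<close>, \<open>M\<^bsub>g \<triangleright> f\<^esub>\<close> is the common dimension. If \<open>f\<close> is
  fixed, \<open>M\<^sub>f\<close> splits into the eigenspaces for the two square roots of \<open>\<tau>(g, g; f)\<close>, and the
  invariants are the dimensions of these eigenspaces. All these numbers are ranks of idempotents
  that are linear combinations of dual functionals. In characteristic zero the rank of an
  idempotent is its trace, and the traces of the dual functionals are the coefficients of the
  character of \<open>M\<close>. So two comodules with the same character are isomorphic
  (\<open>comod_iso_if_same_character\<close>); the linear algebra behind this is that idempotent matrices of
  equal trace are equivalent (\<open>idempotents_equal_trace_equivalent\<close>).

  The compatibility of \<open>\<sigma>\<close> and \<open>\<tau>\<close> makes the tensor product of two comodules a comodule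
  (\<open>right_comodule_tensor\<close>). Characters are multiplicative on tensor products and additive on direct
  sums, so every isomorphism of the theorem reduces to an identity between products of characters.
  For \<open>f, f' \<in> S\<close> one has
  \<open>(p\<^sub>1 # f + c p\<^sub>g # f) (p\<^sub>1 # f' + c' p\<^sub>g # f') = p\<^sub>1 # ff' + \<sigma>(g; f, f') c c' p\<^sub>g # ff'\<close>. For
  \<open>c\<^sup>2 = \<tau>(g, g; f)\<close> and \<open>c'\<^sup>2 = \<tau>(g, g; f')\<close> the square of the new coefficient is
  \<open>\<tau>(g, g; ff')\<close>, so it is the chosen square root at \<open>ff'\<close> up to a sign, and this sign decides
  between \<open>U\<close> and \<open>V\<close>. A product with the character \<open>p\<^sub>1 # f + p\<^sub>1 # (g \<triangleright> f)\<close> of some \<open>W\<close> has no term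
  at \<open>p\<^sub>g\<close>, and it is a sum of elements \<open>p\<^sub>1 # h + p\<^sub>1 # (g \<triangleright> h)\<close>; such an element is the character
  of \<open>W\<close> at \<open>h\<close> if \<open>h\<close> is moved, and the sum of the characters of \<open>U\<close> and \<open>V\<close> at \<open>h\<close> if \<open>h\<close>
  is fixed.
\<close>

section \<open>Idempotent matrices and their traces\<close>

definition mscale :: "'k::field \<Rightarrow> 'k ^ 'i ^ 'j \<Rightarrow> 'k ^ 'i ^ 'j" where
  "mscale c A = (\<chi> i j. c * A $ i $ j)"

lemma mscale_mult_left: "mscale c A ** B = mscale c (A ** B)"
  by (simp add: mscale_def matrix_matrix_mult_def vec_eq_iff sum_distrib_left mult.assoc)

lemma mscale_mult_right: "A ** mscale c B = mscale c (A ** B)"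
  by (simp add: mscale_def matrix_matrix_mult_def vec_eq_iff sum_distrib_left mult.left_commute)

lemma mscale_mscale: "mscale c (mscale d A) = mscale (c * d) A"
  by (simp add: mscale_def vec_eq_iff mult.assoc)

lemma mscale_one [simp]: "mscale 1 A = A"
  by (simp add: mscale_def vec_eq_iff)

lemma trace_mscale: "trace (mscale c A) = c * trace A"
  by (simp add: mscale_def trace_def sum_distrib_left)

lemma matrix_mult_sum_left: "(\<Sum>x\<in>X. M x) ** A = (\<Sum>x\<in>X. M x ** A)"
  for A :: "'k::field ^ 'l ^ 'i"
  by (induction X rule: infinite_finite_induct)
    (simp_all add: matrix_matrix_mult_def vec_eq_iff distrib_right sum.distrib)

lemma matrix_mult_sum_right: "A ** (\<Sum>x\<in>X. M x) = (\<Sum>x\<in>X. A ** M x)"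
  for A :: "'k::field ^ 'i ^ 'l"
  by (induction X rule: infinite_finite_induct)
    (simp_all add: matrix_add_ldistrib)

lemma matrix_add_mult: "(A + B) ** M = A ** M + B ** M"
  for M :: "'k::field ^ 'l ^ 'i"
  by (simp add: matrix_matrix_mult_def vec_eq_iff distrib_right sum.distrib)

lemma matrix_diff_mult: "(A - B) ** M = A ** M - B ** M"
  for M :: "'k::field ^ 'l ^ 'i"
  by (simp add: matrix_matrix_mult_def vec_eq_iff left_diff_distrib sum_subtractf)

lemma matrix_mult_diff: "M ** (A - B) = M ** A - M ** B"
  for M :: "'k::field ^ 'l ^ 'i"
  by (simp add: matrix_matrix_mult_def vec_eq_iff right_diff_distrib sum_subtractf)

text \<open>
  The vectors \<open>b p\<close> form a basis of the image of \<open>E\<close>, and \<open>l p\<close> takes the coordinate of \<open>E x\<close>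
  at \<open>b p\<close>. Since \<open>E\<close> fixes its image, the \<open>l p\<close> restrict to the dual basis there.
\<close>
lemma idempotent_rank_factorization:
  fixes E :: "'k::field ^ 'i ^ 'i"
  assumes "E ** E = E"
  obtains n :: nat and b l :: "nat \<Rightarrow> 'k ^ 'i"
  where "\<And>p q. p < n \<Longrightarrow> q < n \<Longrightarrow> (\<Sum>i\<in>UNIV. l p $ i * b q $ i) = (if p = q then 1 else 0)"
    and "\<And>i j. E $ i $ j = (\<Sum>p<n. b p $ i * l p $ j)"
proof -
  obtain B where B: "B \<subseteq> range ((*v) E)" "vec.independent B" "range ((*v) E) \<subseteq> vec.span B"
    using vec.basis_exists[of "range ((*v) E)"] by metis
  have finB: "finite B"
    using B(2) by (rule vec.finiteI_independent)
  obtain h where h: "bij_betw h {0..<card B} B"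
    using ex_bij_betw_nat_finite[OF finB] by blast
  define n where "n = card B"
  define l :: "nat \<Rightarrow> 'k ^ 'i" where
    "l p = (\<chi> j. vec.representation B (E *v axis j 1) (h p))" for p
  have hB: "h p \<in> B" if "p < n" for p
    using h that by (auto simp: bij_betw_def n_def)
  have spanE: "E *v x \<in> vec.span B" for x
    using B(3) by auto
  have fixE: "E *v v = v" if v: "v \<in> B" for v
  proof -
    obtain x where "v = E *v x" using B(1) v by blast
    then show ?thesis by (simp add: matrix_vector_mul_assoc assms)
  qed
  have col: "E *v axis j 1 = column j E" for j
    by (simp add: matrix_vector_mult_def column_def axis_def vec_eq_iff if_distrib[of "(*) _"] cong: if_cong)
  show thesis
  proof
    fix p q assume pq: "p < n" "q < n"
    have "(\<Sum>i\<in>UNIV. l p $ i * h q $ i)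
        = (\<Sum>i\<in>UNIV. vec.representation B (h q $ i *s (E *v axis i 1)) (h p))"
      by (simp add: l_def vec.representation_scale[OF B(2) spanE] mult.commute)
    also have "\<dots> = vec.representation B (\<Sum>i\<in>UNIV. h q $ i *s (E *v axis i 1)) (h p)"
      by (subst vec.representation_sum[OF B(2)]) (auto intro: vec.span_scale spanE)
    also have "(\<Sum>i\<in>UNIV. h q $ i *s (E *v axis i 1)) = E *v h q"
      by (simp only: matrix_mult_sum[of E "h q"] col)
    also have "\<dots> = h q" using fixE hB pq by simp
    also have "vec.representation B (h q) (h p) = (if p = q then 1 else 0)"
      using vec.representation_basis[OF B(2) hB[OF pq(2)]] h pq
      by (auto simp: bij_betw_def inj_on_def n_def)
    finally show "(\<Sum>i\<in>UNIV. l p $ i * h q $ i) = (if p = q then 1 else 0)" .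
  next
    fix i j
    have "E *v axis j 1 = (\<Sum>v\<in>B. vec.representation B (E *v axis j 1) v *s v)"
      using vec.sum_representation_eq[OF B(2) spanE finB] by simp
    also have "\<dots> = (\<Sum>p\<in>{0..<card B}. vec.representation B (E *v axis j 1) (h p) *s h p)"
      by (rule sum.reindex_bij_betw[OF h, symmetric])
    finally have "(E *v axis j 1) $ i = (\<Sum>p\<in>{0..<card B}. vec.representation B (E *v axis j 1) (h p) *s h p) $ i"
      by (rule arg_cong[where f = "\<lambda>v. v $ i"])
    also have "\<dots> = (\<Sum>p<n. h p $ i * l p $ j)"
      by (simp add: l_def n_def lessThan_atLeast0 mult.commute)
    finally have "(E *v axis j 1) $ i = (\<Sum>p<n. h p $ i * l p $ j)" .
    moreover have "(E *v axis j 1) $ i = E $ i $ j"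
      by (simp add: col column_def)
    ultimately show "E $ i $ j = (\<Sum>p<n. h p $ i * l p $ j)" by simp
  qed
qed

lemma rank_factors_mult:
  fixes u :: "nat \<Rightarrow> 'k::field ^ 'i" and l b :: "nat \<Rightarrow> 'k ^ 'm" and w :: "nat \<Rightarrow> 'k ^ 'j"
  assumes "\<And>p q. p < n \<Longrightarrow> q < n \<Longrightarrow> (\<Sum>i\<in>UNIV. l p $ i * b q $ i) = (if p = q then 1 else 0)"
  shows "(\<chi> i m. \<Sum>p<n. u p $ i * l p $ m) ** (\<chi> m j. \<Sum>p<n. b p $ m * w p $ j)
    = (\<chi> i j. \<Sum>p<n. u p $ i * w p $ j)"
proof -
  have "(\<Sum>m\<in>UNIV. (\<Sum>p<n. u p $ i * l p $ m) * (\<Sum>q<n. b q $ m * w q $ j))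
    = (\<Sum>p<n. u p $ i * w p $ j)" for i j
  proof -
    have "(\<Sum>m\<in>UNIV. (\<Sum>p<n. u p $ i * l p $ m) * (\<Sum>q<n. b q $ m * w q $ j))
      = (\<Sum>m\<in>UNIV. \<Sum>p<n. \<Sum>q<n. u p $ i * w q $ j * (l p $ m * b q $ m))"
      by (simp add: sum_product mult_ac)
    also have "\<dots> = (\<Sum>p<n. \<Sum>q<n. \<Sum>m\<in>UNIV. u p $ i * w q $ j * (l p $ m * b q $ m))"
      by (subst sum.swap, rule sum.cong[OF refl], subst sum.swap, rule refl)
    also have "\<dots> = (\<Sum>p<n. \<Sum>q<n. if p = q then u p $ i * w q $ j else 0)"
      by (intro sum.cong refl) (simp add: sum_distrib_left[symmetric] assms)
    also have "\<dots> = (\<Sum>p<n. u p $ i * w p $ j)"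
      by (simp add: sum.delta')
    finally show ?thesis .
  qed
  then show ?thesis by (simp add: matrix_matrix_mult_def vec_eq_iff)
qed

text \<open>
  Murray-von Neumann equivalence of idempotents: \<open>Y\<close> and \<open>Z\<close> restrict to mutually inverse
  isomorphisms between the images of \<open>E\<close> and \<open>E'\<close>, and vanish on their kernels.
\<close>
definition mat_equiv :: "'k::field ^ 'i ^ 'i \<Rightarrow> 'k ^ 'j ^ 'j \<Rightarrow> 'k ^ 'i ^ 'j \<Rightarrow> 'k ^ 'j ^ 'i \<Rightarrow> bool" where
  "mat_equiv E E' Y Z \<longleftrightarrow> Z ** Y = E \<and> Y ** Z = E' \<and>
     E' ** Y = Y \<and> Y ** E = Y \<and> E ** Z = Z \<and> Z ** E' = Z"

text \<open>
  The trace of an idempotent is the number of terms in its rank factorization, and in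
  characteristic zero that number can be read off from its image in the field. With equally many
  terms, \<open>Y\<close> and \<open>Z\<close> match the two bases term by term.
\<close>
lemma idempotents_equal_trace_equivalent:
  fixes E :: "'k::field_char_0 ^ 'i ^ 'i" and E' :: "'k ^ 'j ^ 'j"
  assumes "E ** E = E" "E' ** E' = E'" "trace E = trace E'"
  obtains Y Z where "mat_equiv E E' Y Z"
proof -
  obtain n and b l :: "nat \<Rightarrow> 'k ^ 'i" where
    dual: "\<And>p q. p < n \<Longrightarrow> q < n \<Longrightarrow> (\<Sum>i\<in>UNIV. l p $ i * b q $ i) = (if p = q then 1 else 0)"
    and E: "\<And>i j. E $ i $ j = (\<Sum>p<n. b p $ i * l p $ j)"
    by (rule idempotent_rank_factorization[OF assms(1)]) (rule that)
  obtain n' and b' l' :: "nat \<Rightarrow> 'k ^ 'j" where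
    dual': "\<And>p q. p < n' \<Longrightarrow> q < n' \<Longrightarrow> (\<Sum>i\<in>UNIV. l' p $ i * b' q $ i) = (if p = q then 1 else 0)"
    and E': "\<And>i j. E' $ i $ j = (\<Sum>p<n'. b' p $ i * l' p $ j)"
    by (rule idempotent_rank_factorization[OF assms(2)]) (rule that)
  have "trace E = (\<Sum>p<n. \<Sum>i\<in>UNIV. l p $ i * b p $ i)"
    unfolding trace_def E by (subst sum.swap) (simp add: mult.commute)
  then have "trace E = of_nat n" by (simp add: dual)
  moreover have "trace E' = (\<Sum>p<n'. \<Sum>i\<in>UNIV. l' p $ i * b' p $ i)"
    unfolding trace_def E' by (subst sum.swap) (simp add: mult.commute)
  then have "trace E' = of_nat n'" by (simp add: dual')
  ultimately have n': "n' = n" using assms(3) by simp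
  define Y :: "'k ^ 'i ^ 'j" where "Y = (\<chi> j i. \<Sum>p<n. b' p $ j * l p $ i)"
  define Z :: "'k ^ 'j ^ 'i" where "Z = (\<chi> i j. \<Sum>p<n. b p $ i * l' p $ j)"
  have EM: "E = (\<chi> i j. \<Sum>p<n. b p $ i * l p $ j)" "E' = (\<chi> i j. \<Sum>p<n. b' p $ i * l' p $ j)"
    by (simp_all add: vec_eq_iff E E' n')
  have "Z ** Y = E" "Y ** Z = E'" "E' ** Y = Y" "Y ** E = Y" "E ** Z = Z" "Z ** E' = Z"
    unfolding EM Y_def Z_def
    by (rule rank_factors_mult, rule dual dual'[unfolded n'], assumption, assumption)+
  then show thesis
    using that unfolding mat_equiv_def by blast
qed

lemma mat_equiv_orthogonal:
  fixes E1 E2 :: "'k::field ^ 'i ^ 'i" and E1' E2' :: "'k ^ 'j ^ 'j"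
  assumes 1: "mat_equiv E1 E1' Y1 Z1" and 2: "mat_equiv E2 E2' Y2 Z2"
    and orth: "E1 ** E2 = 0" "E1' ** E2' = 0"
  shows "Y1 ** E2 = 0" "E1' ** Y2 = 0" "E1 ** Z2 = 0" "Z1 ** E2' = 0" "Z1 ** Y2 = 0" "Y1 ** Z2 = 0"
  using 1 2 orth unfolding mat_equiv_def
  by (metis matrix_mul_assoc times0_left times0_right)+

text \<open>
  The second conclusion says that \<open>Y1 + Y2\<close> intertwines the involutions that are \<open>1\<close> on the image
  of the first idempotent and \<open>-1\<close> on the image of the second.
\<close>
lemma mat_equiv_add:
  fixes E1 E2 :: "'k::field ^ 'i ^ 'i" and E1' E2' :: "'k ^ 'j ^ 'j"
  assumes 1: "mat_equiv E1 E1' Y1 Z1" and 2: "mat_equiv E2 E2' Y2 Z2"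
    and orth: "E1 ** E2 = 0" "E2 ** E1 = 0" "E1' ** E2' = 0" "E2' ** E1' = 0"
  shows "mat_equiv (E1 + E2) (E1' + E2') (Y1 + Y2) (Z1 + Z2)"
    and "(Y1 + Y2) ** (E1 - E2) = (E1' - E2') ** (Y1 + Y2)"
proof -
  note zero = mat_equiv_orthogonal[OF 1 2 orth(1,3)] mat_equiv_orthogonal[OF 2 1 orth(2,4)]
  show "mat_equiv (E1 + E2) (E1' + E2') (Y1 + Y2) (Z1 + Z2)"
    using 1 2 zero by (simp add: mat_equiv_def matrix_add_ldistrib matrix_add_mult)
  show "(Y1 + Y2) ** (E1 - E2) = (E1' - E2') ** (Y1 + Y2)"
    using 1 2 zero
    by (simp add: mat_equiv_def matrix_add_ldistrib matrix_add_mult matrix_diff_mult matrix_mult_diff)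
qed

text \<open>
  On the image of \<open>X\<close> the matrix \<open>N\<close> is an involution, so its eigenspaces for \<open>1\<close> and \<open>-1\<close> are
  the images of the idempotents \<open>(X + N) / 2\<close> and \<open>(X - N) / 2\<close>, whose traces are determined by those
  of \<open>X\<close> and \<open>N\<close>. Matching the eigenspaces separately gives an equivalence that commutes with the
  involutions.
\<close>
lemma involutions_equal_trace_equivalent:
  fixes X N :: "'k::field_char_0 ^ 'i ^ 'i" and X' N' :: "'k ^ 'j ^ 'j"
  assumes X: "X ** X = X" "X ** N = N" "N ** X = N" "N ** N = X"
    and X': "X' ** X' = X'" "X' ** N' = N'" "N' ** X' = N'" "N' ** N' = X'"
    and tr: "trace X = trace X'" "trace N = trace N'"
  obtains Y Z where "mat_equiv X X' Y Z" "Y ** N = N' ** Y"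
proof -
  define P M where "P = mscale (1/2) (X + N)" and "M = mscale (1/2) (X - N)"
  define P' M' where "P' = mscale (1/2) (X' + N')" and "M' = mscale (1/2) (X' - N')"
  note defs = P_def M_def P'_def M'_def
  have half: "mscale (1/2) A + mscale (1/2) A = A" for A :: "'k ^ 'm ^ 'l"
    by (simp add: mscale_def vec_eq_iff)
  have idem: "P ** P = P" "M ** M = M" "P ** M = 0" "M ** P = 0"
    "P' ** P' = P'" "M' ** M' = M'" "P' ** M' = 0" "M' ** P' = 0"
    unfolding defs by (simp_all add: mscale_mult_left mscale_mult_right mscale_mscale
        matrix_add_ldistrib matrix_add_mult matrix_diff_mult matrix_mult_diff X X')
      (simp_all add: mscale_def vec_eq_iff algebra_simps)
  have PM: "P + M = X" "P - M = N" "P' + M' = X'" "P' - M' = N'"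
    unfolding defs by (simp_all add: mscale_def vec_eq_iff algebra_simps)
  have trPM: "trace P = trace P'" "trace M = trace M'"
    unfolding defs by (simp_all add: trace_mscale trace_add trace_sub tr)
  obtain Y1 Z1 where 1: "mat_equiv P P' Y1 Z1"
    using idempotents_equal_trace_equivalent[OF idem(1,5) trPM(1)] .
  obtain Y2 Z2 where 2: "mat_equiv M M' Y2 Z2"
    using idempotents_equal_trace_equivalent[OF idem(2,6) trPM(2)] .
  show thesis
    using that mat_equiv_add[OF 1 2 idem(3,4,7,8)] unfolding PM by blast
qed

text \<open>
  Here \<open>u\<close> maps the image of \<open>E1\<close> isomorphically onto that of \<open>E2\<close> with inverse \<open>c u'\<close>, and \<open>v\<close>
  does the same on the other side. Conjugating by them moves an equivalence on \<open>E1\<close> to the only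
  equivalence on \<open>E2\<close> that intertwines these isomorphisms.
\<close>
lemma mat_equiv_transport:
  fixes u u' E1 E2 :: "'k::field ^ 'i ^ 'i" and v v' E1' E2' :: "'k ^ 'j ^ 'j"
  assumes YZ: "mat_equiv E1 E1' Y Z"
    and u: "u' ** u = mscale t E1" "u ** u' = mscale t E2" "E2 ** u = u" "u' ** E2 = u'" "E1 ** u' = u'"
    and v: "v' ** v = mscale t E1'" "v ** v' = mscale t E2'" "E2' ** v = v" "v' ** E2' = v'" "E1' ** v' = v'"
    and ct: "c * t = 1"
  shows "mat_equiv E2 E2' (mscale c (v ** Y ** u')) (mscale c (u ** Z ** v'))"
    and "mscale c (v ** Y ** u') ** u = v ** Y"
    and "v' ** mscale c (v ** Y ** u') = Y ** u'"
proof -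
  have "u ** Z ** v' ** (v ** Y ** u') = u ** Z ** (v' ** v) ** Y ** u'"
    by (simp add: matrix_mul_assoc)
  also have "\<dots> = mscale t (u ** ((Z ** E1') ** Y) ** u')"
    by (simp add: v mscale_mult_left mscale_mult_right matrix_mul_assoc)
  also have "\<dots> = mscale t (u ** (E1 ** u'))"
    using YZ by (simp add: mat_equiv_def matrix_mul_assoc)
  also have "\<dots> = mscale (t * t) E2"
    by (simp add: u mscale_mscale)
  finally have ZY: "mscale c (u ** Z ** v') ** mscale c (v ** Y ** u') = E2"
    by (simp add: mscale_mult_left mscale_mult_right mscale_mscale) (metis ct mscale_one mult.assoc mult.left_commute mult_1_left)
  have "v ** Y ** u' ** (u ** Z ** v') = v ** Y ** (u' ** u) ** Z ** v'"
    by (simp add: matrix_mul_assoc)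
  also have "\<dots> = mscale t (v ** ((Y ** E1) ** Z) ** v')"
    by (simp add: u mscale_mult_left mscale_mult_right matrix_mul_assoc)
  also have "\<dots> = mscale t (v ** (E1' ** v'))"
    using YZ by (simp add: mat_equiv_def matrix_mul_assoc)
  also have "\<dots> = mscale (t * t) E2'"
    by (simp add: v mscale_mscale)
  finally have YZ': "mscale c (v ** Y ** u') ** mscale c (u ** Z ** v') = E2'"
    by (simp add: mscale_mult_left mscale_mult_right mscale_mscale) (metis ct mscale_one mult.assoc mult.left_commute mult_1_left)
  have unit: "E2' ** (v ** Y ** u') = v ** Y ** u'" "v ** Y ** u' ** E2 = v ** Y ** u'"
    "E2 ** (u ** Z ** v') = u ** Z ** v'" "u ** Z ** v' ** E2' = u ** Z ** v'"
    by (metis matrix_mul_assoc u(3,4) v(3,4))+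
  show "mat_equiv E2 E2' (mscale c (v ** Y ** u')) (mscale c (u ** Z ** v'))"
    using ZY YZ' unit by (simp add: mat_equiv_def mscale_mult_left mscale_mult_right)
  have "v ** Y ** u' ** u = v ** (Y ** (u' ** u))" by (simp add: matrix_mul_assoc)
  then show "mscale c (v ** Y ** u') ** u = v ** Y"
    using YZ by (simp add: u ct mscale_mult_left mscale_mult_right mscale_mscale mat_equiv_def)
  have "v' ** (v ** Y ** u') = (v' ** v) ** Y ** u'" by (simp add: matrix_mul_assoc)
  then show "v' ** mscale c (v ** Y ** u') = Y ** u'"
    using YZ by (simp add: v ct mscale_mult_left mscale_mult_right mscale_mscale mat_equiv_def)
qed

section \<open>Coordinates in the Hopf algebra\<close>

lemma lookup_smul [simp]: "Poly_Mapping.lookup (smul c x) s = c * Poly_Mapping.lookup x s"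
  by (simp add: smul_def Poly_Mapping.map.rep_eq when_def)

lemma keys_smul: "Poly_Mapping.keys (smul c x) \<subseteq> Poly_Mapping.keys x"
  by (auto simp: in_keys_iff)

lemma smul_zero [simp]: "smul c 0 = 0"
  by (rule poly_mapping_eqI) simp

lemma smul_one [simp]: "smul 1 x = x"
  by (rule poly_mapping_eqI) simp

lemma smul_smul: "smul c (smul d x) = smul (c * d) x"
  by (rule poly_mapping_eqI) (simp add: mult.assoc)

lemma lookup_lin_extend:
  assumes "finite A" "Poly_Mapping.keys x \<subseteq> A"
  shows "Poly_Mapping.lookup (lin_extend \<phi> x) t
    = (\<Sum>s\<in>A. Poly_Mapping.lookup x s * Poly_Mapping.lookup (\<phi> s) t)"
  unfolding lin_extend_def lookup_sum
  by (rule sum.mono_neutral_cong_left[OF assms]) (auto simp: in_keys_iff)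

lemma lin_extend_add: "lin_extend \<phi> (x + y) = lin_extend \<phi> x + lin_extend \<phi> y"
proof (rule poly_mapping_eqI)
  fix t
  let ?A = "Poly_Mapping.keys x \<union> Poly_Mapping.keys y"
  show "Poly_Mapping.lookup (lin_extend \<phi> (x + y)) t
      = Poly_Mapping.lookup (lin_extend \<phi> x + lin_extend \<phi> y) t"
    using Poly_Mapping.keys_add[of x y]
    by (simp add: lookup_lin_extend[of ?A] lookup_add sum.distrib distrib_right)
qed

lemma lin_extend_smul: "lin_extend \<phi> (smul c x) = smul c (lin_extend \<phi> x)"
  by (rule poly_mapping_eqI)
    (simp add: lookup_lin_extend[OF finite_keys keys_smul, of _ c x]
      lookup_lin_extend[OF finite_keys order_refl, of _ x] sum_distrib_left mult.assoc)

lemma lin_extend_zero [simp]: "lin_extend \<phi> 0 = 0"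
  by (simp add: lin_extend_def)

lemma lin_extend_single [simp]: "lin_extend \<phi> (Poly_Mapping.single s 1) = \<phi> s"
  by (rule poly_mapping_eqI) (simp add: lookup_lin_extend[OF _ order_refl])

lemma lin_extend_add_fun: "lin_extend (\<lambda>s. \<phi> s + \<psi> s) x = lin_extend \<phi> x + lin_extend \<psi> x"
  by (rule poly_mapping_eqI)
    (simp add: lookup_lin_extend[OF _ order_refl] lookup_add sum.distrib distrib_left)

lemma lin_extend_smul_fun: "lin_extend (\<lambda>s. smul c (\<phi> s)) x = smul c (lin_extend \<phi> x)"
  by (rule poly_mapping_eqI)
    (simp add: lookup_lin_extend[OF _ order_refl] sum_distrib_left mult.left_commute)

lemma lookup_tensor_elt:
  "Poly_Mapping.lookup (tensor_elt x y) (s, t) = Poly_Mapping.lookup x s * Poly_Mapping.lookup y t"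
proof -
  have inner: "Poly_Mapping.lookup (lin_extend (\<lambda>t. Poly_Mapping.single (s', t) 1) y) (s, t)
      = (if s' = s then Poly_Mapping.lookup y t else 0)" for s'
    by (simp add: lookup_lin_extend[OF _ order_refl] lookup_single when_def in_keys_iff
        if_distrib[of "(*) _"] cong: if_cong)
  show ?thesis
    unfolding tensor_elt_def
    by (simp add: lookup_lin_extend[OF _ order_refl] inner in_keys_iff if_distrib[of "(*) _"] cong: if_cong)
qed

lemma lookup_hbasis:
  "Poly_Mapping.lookup (hbasis a f) (b, h) = (if a = b \<and> f = h then 1 else 0)"
  by (simp add: hbasis_def lookup_single when_def)

lemma hmult_hbasis:
  "hmult F ra \<sigma> (hbasis a f) (hbasis b f')
    = (if ra a f = b then smul (\<sigma> a f f') (hbasis a (f \<otimes>\<^bsub>F\<^esub> f')) else 0)"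
  by (simp add: hmult_def hbasis_def)

lemma hmult_add_left: "hmult F ra \<sigma> (x + y) z = hmult F ra \<sigma> x z + hmult F ra \<sigma> y z"
  by (simp add: hmult_def lin_extend_add)

lemma hmult_add_right: "hmult F ra \<sigma> x (y + z) = hmult F ra \<sigma> x y + hmult F ra \<sigma> x z"
  by (simp add: hmult_def lin_extend_add lin_extend_add_fun[symmetric] case_prod_unfold)

lemma hmult_smul_left: "hmult F ra \<sigma> (smul c x) y = smul c (hmult F ra \<sigma> x y)"
  by (simp add: hmult_def lin_extend_smul)

lemma hmult_smul_right: "hmult F ra \<sigma> x (smul c y) = smul c (hmult F ra \<sigma> x y)"
  by (simp add: hmult_def lin_extend_smul lin_extend_smul_fun[symmetric] case_prod_unfold)

lemma hmult_zero_left [simp]: "hmult F ra \<sigma> 0 x = 0"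
  by (simp add: hmult_def)

lemma hmult_zero_right [simp]: "hmult F ra \<sigma> x 0 = 0"
  by (simp add: hmult_def case_prod_unfold) (simp add: lin_extend_def)

lemma hmult_sum_left: "hmult F ra \<sigma> (\<Sum>i\<in>I. x i) y = (\<Sum>i\<in>I. hmult F ra \<sigma> (x i) y)"
  by (induction I rule: infinite_finite_induct) (simp_all add: hmult_add_left)

lemma hmult_sum_right: "hmult F ra \<sigma> x (\<Sum>i\<in>I. y i) = (\<Sum>i\<in>I. hmult F ra \<sigma> x (y i))"
  by (induction I rule: infinite_finite_induct) (simp_all add: hmult_add_right)

text \<open>
  Finite sets \<open>A\<close> and \<open>B\<close> larger than the supports are allowed, so that the products occurring in one
  computation can all be summed over the same index sets.
\<close>
lemma lookup_hmult:
  assumes A: "finite A" "snd ` Poly_Mapping.keys x \<subseteq> A"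
    and B: "finite B" "snd ` Poly_Mapping.keys y \<subseteq> B"
  shows "Poly_Mapping.lookup (hmult F ra \<sigma> x y) (a, h)
    = (\<Sum>f\<in>A. \<Sum>f'\<in>B. if f \<otimes>\<^bsub>F\<^esub> f' = h
        then \<sigma> a f f' * Poly_Mapping.lookup x (a, f) * Poly_Mapping.lookup y (ra a f, f') else 0)"
proof -
  let ?\<psi> = "\<lambda>c f. lin_extend (\<lambda>(b, f'). if ra c f = b then smul (\<sigma> c f f') (hbasis c (f \<otimes>\<^bsub>F\<^esub> f')) else 0) y"
  have inner: "Poly_Mapping.lookup (?\<psi> c f) (a, h)
      = (if c = a then \<Sum>f'\<in>B. if f \<otimes>\<^bsub>F\<^esub> f' = h then \<sigma> a f f' * Poly_Mapping.lookup y (ra a f, f') else 0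
         else 0)" for c f
  proof -
    define Y where "Y = insert (ra c f) (fst ` Poly_Mapping.keys y)"
    have Y: "finite (Y \<times> B)" "Poly_Mapping.keys y \<subseteq> Y \<times> B" "ra c f \<in> Y"
      using B by (auto simp: Y_def image_subset_iff intro: rev_image_eqI)
    have "Poly_Mapping.lookup (?\<psi> c f) (a, h)
      = (\<Sum>b\<in>Y. \<Sum>f'\<in>B. if b = ra c f then (if c = a \<and> f \<otimes>\<^bsub>F\<^esub> f' = h then \<sigma> c f f' * Poly_Mapping.lookup y (b, f') else 0) else 0)"
      by (subst lookup_lin_extend[OF Y(1,2)])
        (auto simp: sum.cartesian_product lookup_hbasis intro!: sum.cong)
    also have "\<dots> = (\<Sum>f'\<in>B. \<Sum>b\<in>Y. if b = ra c f then (if c = a \<and> f \<otimes>\<^bsub>F\<^esub> f' = h then \<sigma> c f f' * Poly_Mapping.lookup y (b, f') else 0) else 0)"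
      by (rule sum.swap)
    also have "\<dots> = (\<Sum>f'\<in>B. if c = a \<and> f \<otimes>\<^bsub>F\<^esub> f' = h then \<sigma> c f f' * Poly_Mapping.lookup y (ra c f, f') else 0)"
      using Y(3) by (simp add: Y_def)
    finally show ?thesis by (auto intro!: sum.cong)
  qed
  define X where "X = insert a (fst ` Poly_Mapping.keys x)"
  have X: "finite (X \<times> A)" "Poly_Mapping.keys x \<subseteq> X \<times> A" "a \<in> X"
    using A by (auto simp: X_def image_subset_iff intro: rev_image_eqI)
  have "Poly_Mapping.lookup (hmult F ra \<sigma> x y) (a, h)
      = (\<Sum>c\<in>X. \<Sum>f\<in>A. if c = a then Poly_Mapping.lookup x (c, f) *
          (\<Sum>f'\<in>B. if f \<otimes>\<^bsub>F\<^esub> f' = h then \<sigma> a f f' * Poly_Mapping.lookup y (ra a f, f') else 0) else 0)"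
    unfolding hmult_def
    by (subst lookup_lin_extend[OF X(1,2)])
      (auto simp: sum.cartesian_product inner intro!: sum.cong)
  also have "\<dots> = (\<Sum>f\<in>A. \<Sum>c\<in>X. if c = a then Poly_Mapping.lookup x (c, f) *
          (\<Sum>f'\<in>B. if f \<otimes>\<^bsub>F\<^esub> f' = h then \<sigma> a f f' * Poly_Mapping.lookup y (ra a f, f') else 0) else 0)"
    by (rule sum.swap)
  also have "\<dots> = (\<Sum>f\<in>A. Poly_Mapping.lookup x (a, f) *
          (\<Sum>f'\<in>B. if f \<otimes>\<^bsub>F\<^esub> f' = h then \<sigma> a f f' * Poly_Mapping.lookup y (ra a f, f') else 0))"
    using X(3) by (simp add: X_def)
  finally show ?thesis
    by (auto simp: sum_distrib_left mult_ac intro!: sum.cong)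
qed

lemma keys_hmultE:
  assumes "(a, h) \<in> Poly_Mapping.keys (hmult F ra \<sigma> x y)"
  obtains f f' where "(a, f) \<in> Poly_Mapping.keys x" "(ra a f, f') \<in> Poly_Mapping.keys y"
    "f \<otimes>\<^bsub>F\<^esub> f' = h"
proof -
  let ?g = "\<lambda>f f'. if f \<otimes>\<^bsub>F\<^esub> f' = h
        then \<sigma> a f f' * Poly_Mapping.lookup x (a, f) * Poly_Mapping.lookup y (ra a f, f') else 0"
  have "(\<Sum>f\<in>snd ` Poly_Mapping.keys x. \<Sum>f'\<in>snd ` Poly_Mapping.keys y. ?g f f') \<noteq> 0"
    using assms by (simp add: in_keys_iff lookup_hmult[OF _ order_refl _ order_refl])
  then obtain f where "(\<Sum>f'\<in>snd ` Poly_Mapping.keys y. ?g f f') \<noteq> 0"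
    by (rule sum.not_neutral_contains_not_neutral)
  then obtain f' where "?g f f' \<noteq> 0"
    by (rule sum.not_neutral_contains_not_neutral)
  then show thesis
    by (intro that[of f f']) (auto simp: in_keys_iff split: if_splits)
qed

text \<open>
  In the sum defining \<open>\<Delta>(p\<^sub>c # h)\<close> only the summand at \<open>b\<close> can contribute to the pair
  \<open>((a, f'), (b, f))\<close>, and it does so exactly when \<open>c = ab\<close>, \<open>h = f\<close> and \<open>f' = b \<triangleright> f\<close>.
\<close>
lemma lookup_hcomult:
  fixes x :: "('a, 'b, 'k::field) hopf"
  assumes "group G" "finite (carrier G)" "x \<in> hcarrier F G"
  shows "Poly_Mapping.lookup (hcomult G la \<tau> x) ((a, f'), (b, f))
    = (if a \<in> carrier G \<and> b \<in> carrier G \<and> f' = la b f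
       then \<tau> a b f * Poly_Mapping.lookup x (a \<otimes>\<^bsub>G\<^esub> b, f) else 0)"
proof -
  interpret G: group G by fact
  let ?X = "Poly_Mapping.keys x"
  have tens: "tensor_elt (hbasis c h) (hbasis d h') = Poly_Mapping.single ((c, h), (d, h')) (1::'k)"
    for c d :: 'a and h h' :: 'b
    by (simp add: tensor_elt_def hbasis_def)
  have summand: "Poly_Mapping.lookup (\<Sum>y\<in>carrier G. smul (\<tau> (c \<otimes>\<^bsub>G\<^esub> inv\<^bsub>G\<^esub> y) y h)
         (tensor_elt (hbasis (c \<otimes>\<^bsub>G\<^esub> inv\<^bsub>G\<^esub> y) (la y h)) (hbasis y h))) ((a, f'), (b, f))
     = (if (c, h) = (a \<otimes>\<^bsub>G\<^esub> b, f) then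
          if a \<in> carrier G \<and> b \<in> carrier G \<and> f' = la b f then \<tau> a b f else 0 else 0)"
    if c: "c \<in> carrier G" for c h
  proof -
    have "Poly_Mapping.lookup (\<Sum>y\<in>carrier G. smul (\<tau> (c \<otimes>\<^bsub>G\<^esub> inv\<^bsub>G\<^esub> y) y h)
         (tensor_elt (hbasis (c \<otimes>\<^bsub>G\<^esub> inv\<^bsub>G\<^esub> y) (la y h)) (hbasis y h))) ((a, f'), (b, f))
      = (\<Sum>y\<in>carrier G. if y = b then
           (if c \<otimes>\<^bsub>G\<^esub> inv\<^bsub>G\<^esub> y = a \<and> la y h = f' \<and> h = f then \<tau> a y h else 0) else 0)"
      by (auto simp: lookup_sum tens lookup_single when_def intro!: sum.cong)
    also have "\<dots> = (if b \<in> carrier G then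
        (if c \<otimes>\<^bsub>G\<^esub> inv\<^bsub>G\<^esub> b = a \<and> la b h = f' \<and> h = f then \<tau> a b h else 0) else 0)"
      using assms(2) by simp
    also have "\<dots> = (if (c, h) = (a \<otimes>\<^bsub>G\<^esub> b, f) then
          if a \<in> carrier G \<and> b \<in> carrier G \<and> f' = la b f then \<tau> a b f else 0 else 0)"
    proof (cases "a \<in> carrier G \<and> b \<in> carrier G")
      case True
      then have "c \<otimes>\<^bsub>G\<^esub> inv\<^bsub>G\<^esub> b = a \<longleftrightarrow> c = a \<otimes>\<^bsub>G\<^esub> b"
        using c G.inv_solve_right' by auto
      then show ?thesis using True by auto
    next
      case False
      then show ?thesis using c by auto
    qed
    finally show ?thesis .
  qed
  have "Poly_Mapping.lookup (hcomult G la \<tau> x) ((a, f'), (b, f))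
     = (\<Sum>s\<in>?X. Poly_Mapping.lookup x s * (if s = (a \<otimes>\<^bsub>G\<^esub> b, f) then
          if a \<in> carrier G \<and> b \<in> carrier G \<and> f' = la b f then \<tau> a b f else 0 else 0))"
    unfolding hcomult_def
    apply (subst lookup_lin_extend[OF finite_keys order_refl])
    apply (rule sum.cong[OF refl])
    subgoal for s
      using assms(3) summand[of "fst s" "snd s"]
      by (cases s) (auto simp: hcarrier_def)
    done
  also have "\<dots> = (\<Sum>s\<in>?X. if s = (a \<otimes>\<^bsub>G\<^esub> b, f) then Poly_Mapping.lookup x s * (
          if a \<in> carrier G \<and> b \<in> carrier G \<and> f' = la b f then \<tau> a b f else 0) else 0)"
    by (intro sum.cong) auto
  also have "\<dots> = (if a \<in> carrier G \<and> b \<in> carrier G \<and> f' = la b f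
       then \<tau> a b f * Poly_Mapping.lookup x (a \<otimes>\<^bsub>G\<^esub> b, f) else 0)"
    by (simp add: in_keys_iff)
  finally show ?thesis .
qed

lemma hcounit_eq:
  assumes "finite A" "snd ` Poly_Mapping.keys x \<subseteq> A"
  shows "hcounit G x = (\<Sum>f\<in>A. Poly_Mapping.lookup x (\<one>\<^bsub>G\<^esub>, f))"
proof -
  define X where "X = insert \<one>\<^bsub>G\<^esub> (fst ` Poly_Mapping.keys x)"
  have X: "finite (X \<times> A)" "Poly_Mapping.keys x \<subseteq> X \<times> A" "\<one>\<^bsub>G\<^esub> \<in> X"
    using assms by (auto simp: X_def image_subset_iff intro: rev_image_eqI)
  have "hcounit G x = (\<Sum>(a, f)\<in>X \<times> A. Poly_Mapping.lookup x (a, f) * (if a = \<one>\<^bsub>G\<^esub> then 1 else 0))"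
    unfolding hcounit_def by (rule sum.mono_neutral_left[OF X(1,2)]) (auto simp: in_keys_iff)
  also have "\<dots> = (\<Sum>f\<in>A. \<Sum>a\<in>X. if a = \<one>\<^bsub>G\<^esub> then Poly_Mapping.lookup x (a, f) else 0)"
    unfolding sum.cartesian_product[symmetric] by (subst sum.swap) (auto intro!: sum.cong)
  also have "\<dots> = (\<Sum>f\<in>A. Poly_Mapping.lookup x (\<one>\<^bsub>G\<^esub>, f))"
    using X(3) by (simp add: X_def)
  finally show ?thesis .
qed

section \<open>Comodules as families of matrices\<close>

text \<open>
  The matrix by which the functional dual to \<open>p\<^sub>a # f\<close> acts on the comodule.
\<close>
definition coeff_mat :: "('i::finite, 'a, 'b, 'k::field) coaction \<Rightarrow> 'a \<Rightarrow> 'b \<Rightarrow> 'k ^ 'i ^ 'i" where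
  "coeff_mat C a f = (\<chi> i j. Poly_Mapping.lookup (C i j) (a, f))"

definition degrees :: "('i::finite, 'a, 'b, 'k::field) coaction \<Rightarrow> 'b set" where
  "degrees C = (\<Union>i. \<Union>j. snd ` Poly_Mapping.keys (C i j))"

lemma finite_degrees: "finite (degrees C)"
  by (simp add: degrees_def)

lemma keys_subset_degrees: "snd ` Poly_Mapping.keys (C i j) \<subseteq> degrees C"
  by (auto simp: degrees_def)

lemma coeff_mat_eq_0:
  assumes "f \<notin> degrees C"
  shows "coeff_mat C a f = 0"
proof -
  have "(a, f) \<notin> Poly_Mapping.keys (C i j)" for i j
    using assms keys_subset_degrees[of C i j] by force
  then show ?thesis by (simp add: coeff_mat_def vec_eq_iff in_keys_iff)
qed

lemma trace_coeff_mat: "trace (coeff_mat C a f) = Poly_Mapping.lookup (comod_character C) (a, f)"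
  by (simp add: trace_def coeff_mat_def comod_character_def lookup_sum)

lemma comod_iso_iff_coeff_mat:
  fixes C :: "('i::finite, 'a, 'b, 'k::field) coaction"
    and D :: "('j::finite, 'a, 'b, 'k) coaction"
  shows "C \<cong>\<^sub>c D \<longleftrightarrow> (\<exists>P :: 'k ^ 'i ^ 'j. invertible P \<and>
    (\<forall>a f. P ** coeff_mat C a f = coeff_mat D a f ** P))"
proof -
  have "(\<Sum>i\<in>UNIV. smul (P $ k $ i) (C i j)) = (\<Sum>l\<in>UNIV. smul (P $ l $ j) (D k l))
    \<longleftrightarrow> (\<forall>a f. (P ** coeff_mat C a f) $ k $ j = (coeff_mat D a f ** P) $ k $ j)"
    for P :: "'k ^ 'i ^ 'j" and k j
  proof -
    have eqs: "Poly_Mapping.lookup (\<Sum>i\<in>UNIV. smul (P $ k $ i) (C i j)) (a, f)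
        = (P ** coeff_mat C a f) $ k $ j"
      and eqs': "Poly_Mapping.lookup (\<Sum>l\<in>UNIV. smul (P $ l $ j) (D k l)) (a, f)
        = (coeff_mat D a f ** P) $ k $ j" for a f
      by (simp_all add: lookup_sum matrix_matrix_mult_def coeff_mat_def mult.commute)
    show ?thesis
      unfolding poly_mapping_eq_iff fun_eq_iff split_paired_All eqs eqs' by (rule refl)
  qed
  then show ?thesis
    by (simp only: comod_iso_def vec_eq_iff) blast
qed

locale bicrossed_data =
  fixes F :: "('b, 'n) monoid_scheme" and G :: "('a, 'm) monoid_scheme"
    and ra :: "'a \<Rightarrow> 'b \<Rightarrow> 'a" and la :: "'a \<Rightarrow> 'b \<Rightarrow> 'b"
    and \<sigma> :: "'a \<Rightarrow> 'b \<Rightarrow> 'b \<Rightarrow> 'k::field" and \<tau> :: "'a \<Rightarrow> 'a \<Rightarrow> 'b \<Rightarrow> 'k"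
  assumes matched: "matched_pair F G ra la"
    and cocycles: "compatible_cocycles F G ra la \<sigma> \<tau>"
    and finite_G: "finite (carrier G)"
begin

sublocale F: group F
  using matched by (simp add: matched_pair_def)

sublocale G: group G
  using matched by (simp add: matched_pair_def)

lemma ra_closed [simp, intro]: "a \<in> carrier G \<Longrightarrow> f \<in> carrier F \<Longrightarrow> ra a f \<in> carrier G"
  and la_closed [simp, intro]: "a \<in> carrier G \<Longrightarrow> f \<in> carrier F \<Longrightarrow> la a f \<in> carrier F"
  and la_one [simp]: "f \<in> carrier F \<Longrightarrow> la \<one>\<^bsub>G\<^esub> f = f"
  and ra_mult: "a \<in> carrier G \<Longrightarrow> f \<in> carrier F \<Longrightarrow> f' \<in> carrier F \<Longrightarrow>
    ra a (f \<otimes>\<^bsub>F\<^esub> f') = ra (ra a f) f'"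
  and ra_one: "a \<in> carrier G \<Longrightarrow> ra a \<one>\<^bsub>F\<^esub> = a"
  and la_la: "a \<in> carrier G \<Longrightarrow> b \<in> carrier G \<Longrightarrow> f \<in> carrier F \<Longrightarrow>
    la a (la b f) = la (a \<otimes>\<^bsub>G\<^esub> b) f"
  and la_mult: "a \<in> carrier G \<Longrightarrow> f \<in> carrier F \<Longrightarrow> f' \<in> carrier F \<Longrightarrow>
    la a (f \<otimes>\<^bsub>F\<^esub> f') = la a f \<otimes>\<^bsub>F\<^esub> la (ra a f) f'"
  and ra_Gmult: "a \<in> carrier G \<Longrightarrow> b \<in> carrier G \<Longrightarrow> f \<in> carrier F \<Longrightarrow>
    ra (a \<otimes>\<^bsub>G\<^esub> b) f = ra a (la b f) \<otimes>\<^bsub>G\<^esub> ra b f"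
  by (insert matched[unfolded matched_pair_def], (elim conjE, metis)+)

lemma \<tau>_nonzero: "a \<in> carrier G \<Longrightarrow> b \<in> carrier G \<Longrightarrow> f \<in> carrier F \<Longrightarrow> \<tau> a b f \<noteq> 0"
  and \<sigma>_one_G [simp]: "f \<in> carrier F \<Longrightarrow> f' \<in> carrier F \<Longrightarrow> \<sigma> \<one>\<^bsub>G\<^esub> f f' = 1"
  and \<tau>_one_left [simp]: "a \<in> carrier G \<Longrightarrow> f \<in> carrier F \<Longrightarrow> \<tau> \<one>\<^bsub>G\<^esub> a f = 1"
  and \<tau>_one_right [simp]: "a \<in> carrier G \<Longrightarrow> f \<in> carrier F \<Longrightarrow> \<tau> a \<one>\<^bsub>G\<^esub> f = 1"
  and \<tau>_cocycle: "a \<in> carrier G \<Longrightarrow> b \<in> carrier G \<Longrightarrow> c \<in> carrier G \<Longrightarrow> f \<in> carrier F \<Longrightarrow>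
    \<tau> a b (la c f) * \<tau> (a \<otimes>\<^bsub>G\<^esub> b) c f = \<tau> a (b \<otimes>\<^bsub>G\<^esub> c) f * \<tau> b c f"
  and \<sigma>_\<tau>_compatible: "a \<in> carrier G \<Longrightarrow> b \<in> carrier G \<Longrightarrow> f \<in> carrier F \<Longrightarrow> f' \<in> carrier F \<Longrightarrow>
    \<sigma> (a \<otimes>\<^bsub>G\<^esub> b) f f' * \<tau> a b (f \<otimes>\<^bsub>F\<^esub> f') =
      \<sigma> a (la b f) (la (ra b f) f') * \<sigma> b f f' * \<tau> a b f * \<tau> (ra a (la b f)) (ra b f) f'"
  by (insert cocycles[unfolded compatible_cocycles_def], (elim conjE, metis)+)

lemma ra_one_G [simp]: assumes "f \<in> carrier F" shows "ra \<one>\<^bsub>G\<^esub> f = \<one>\<^bsub>G\<^esub>"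
proof -
  have "ra \<one>\<^bsub>G\<^esub> f \<otimes>\<^bsub>G\<^esub> ra \<one>\<^bsub>G\<^esub> f = ra \<one>\<^bsub>G\<^esub> f"
    using ra_Gmult[of "\<one>\<^bsub>G\<^esub>" "\<one>\<^bsub>G\<^esub>" f, symmetric] assms by simp
  then show ?thesis using assms G.l_cancel_one by blast
qed

lemma degrees_closed:
  assumes "right_comodule F G la \<tau> C"
  shows "degrees C \<subseteq> carrier F"
  using assms by (force simp: right_comodule_def hcarrier_def degrees_def)

text \<open>
  Coassociativity of the coaction, compared at one basis element of \<open>H \<otimes> H\<close>.
\<close>
lemma comodule_coeff_product:
  assumes C: "right_comodule F G la \<tau> C" and ab: "a \<in> carrier G" "b \<in> carrier G"
  shows "(\<Sum>k\<in>UNIV. Poly_Mapping.lookup (C i k) (a, f') * Poly_Mapping.lookup (C k j) (b, f))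
    = (if f' = la b f then \<tau> a b f * Poly_Mapping.lookup (C i j) (a \<otimes>\<^bsub>G\<^esub> b, f) else 0)"
proof -
  have "Poly_Mapping.lookup (hcomult G la \<tau> (C i j)) ((a, f'), (b, f))
      = Poly_Mapping.lookup (\<Sum>k\<in>UNIV. tensor_elt (C i k) (C k j)) ((a, f'), (b, f))"
    using C by (simp add: right_comodule_def)
  moreover have "C i j \<in> hcarrier F G" using C by (simp add: right_comodule_def)
  ultimately show ?thesis
    by (simp add: lookup_hcomult[OF G.is_group finite_G] lookup_sum lookup_tensor_elt ab)
qed

text \<open>
  The multiplication of the twisted groupoid algebra: \<open>coeff_mat C a f\<close> maps the component of
  degree \<open>f\<close> to the one of degree \<open>a \<triangleright> f\<close>, and compositions follow \<open>G\<close> up to \<open>\<tau>\<close>.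
\<close>
lemma coeff_mat_mult:
  assumes "right_comodule F G la \<tau> C" "a \<in> carrier G" "b \<in> carrier G"
  shows "coeff_mat C a f' ** coeff_mat C b f
    = (if f' = la b f then mscale (\<tau> a b f) (coeff_mat C (a \<otimes>\<^bsub>G\<^esub> b) f) else 0)"
  by (simp add: coeff_mat_def mscale_def matrix_matrix_mult_def vec_eq_iff
      comodule_coeff_product[OF assms])

lemma comodule_counit:
  assumes C: "right_comodule F G la \<tau> C" and A: "finite A" "degrees C \<subseteq> A"
  shows "(\<Sum>f\<in>A. Poly_Mapping.lookup (C i j) (\<one>\<^bsub>G\<^esub>, f)) = (if i = j then 1 else 0)"
proof -
  have "hcounit G (C i j) = (\<Sum>f\<in>A. Poly_Mapping.lookup (C i j) (\<one>\<^bsub>G\<^esub>, f))"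
    by (rule hcounit_eq[OF A(1) order_trans[OF keys_subset_degrees A(2)]])
  then show ?thesis using C by (simp add: right_comodule_def)
qed

lemma sum_coeff_mat_one:
  assumes "right_comodule F G la \<tau> C" "finite A" "degrees C \<subseteq> A"
  shows "(\<Sum>f\<in>A. coeff_mat C \<one>\<^bsub>G\<^esub> f) = mat 1"
  using comodule_counit[OF assms] by (simp add: coeff_mat_def vec_eq_iff mat_def)

lemma coeff_mat_outside:
  assumes "right_comodule F G la \<tau> C" "a \<notin> carrier G"
  shows "coeff_mat C a f = 0"
proof -
  have "(a, f) \<notin> Poly_Mapping.keys (C i j)" for i j
    using assms by (auto simp: right_comodule_def hcarrier_def)
  then show ?thesis by (simp add: coeff_mat_def vec_eq_iff in_keys_iff)
qed

lemma right_comoduleI: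
  fixes C :: "('i::finite, 'a, 'b, 'k) coaction"
  assumes carrier: "\<And>i j. C i j \<in> hcarrier F G"
    and prod: "\<And>i j a b f f'. a \<in> carrier G \<Longrightarrow> b \<in> carrier G \<Longrightarrow> f \<in> carrier F \<Longrightarrow> f' \<in> carrier F \<Longrightarrow>
      (\<Sum>k\<in>UNIV. Poly_Mapping.lookup (C i k) (a, f') * Poly_Mapping.lookup (C k j) (b, f))
      = (if f' = la b f then \<tau> a b f * Poly_Mapping.lookup (C i j) (a \<otimes>\<^bsub>G\<^esub> b, f) else 0)"
    and counit: "\<And>i j. hcounit G (C i j) = (if i = j then 1 else 0)"
  shows "right_comodule F G la \<tau> C"
proof -
  have zero: "Poly_Mapping.lookup (C i j) (a, f) = 0" if "a \<notin> carrier G \<or> f \<notin> carrier F" for i j a f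
    using carrier[of i j] that by (auto simp: hcarrier_def in_keys_iff)
  have "hcomult G la \<tau> (C i j) = (\<Sum>k\<in>UNIV. tensor_elt (C i k) (C k j))" for i j
  proof (rule poly_mapping_eqI)
    fix s :: "('a \<times> 'b) \<times> ('a \<times> 'b)"
    obtain a f' b f where s: "s = ((a, f'), (b, f))" by (metis prod.exhaust)
    show "Poly_Mapping.lookup (hcomult G la \<tau> (C i j)) s
        = Poly_Mapping.lookup (\<Sum>k\<in>UNIV. tensor_elt (C i k) (C k j)) s"
    proof (cases "a \<in> carrier G \<and> b \<in> carrier G \<and> f \<in> carrier F \<and> f' \<in> carrier F")
      case True
      then show ?thesis
        by (simp add: s lookup_hcomult[OF G.is_group finite_G carrier] lookup_sum lookup_tensor_elt prod)
    next
      case False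
      then show ?thesis
        by (cases "f \<in> carrier F") (auto simp: s lookup_hcomult[OF G.is_group finite_G carrier] lookup_sum lookup_tensor_elt zero)
    qed
  qed
  then show ?thesis
    using carrier counit by (simp add: right_comodule_def)
qed

lemma hmult_closed:
  assumes "x \<in> hcarrier F G" "y \<in> hcarrier F G"
  shows "hmult F ra \<sigma> x y \<in> hcarrier F G"
  using assms by (auto simp: hcarrier_def elim!: keys_hmultE)

end

section \<open>Direct sums and tensor products of comodules\<close>

lemma comod_character_tensor:
  "comod_character (comod_tensor F ra \<sigma> C D) = hmult F ra \<sigma> (comod_character C) (comod_character D)"
proof -
  have "comod_character (comod_tensor F ra \<sigma> C D)
      = (\<Sum>p\<in>UNIV \<times> UNIV. hmult F ra \<sigma> (C (fst p) (fst p)) (D (snd p) (snd p)))"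
    unfolding comod_character_def comod_tensor_def UNIV_Times_UNIV by (simp add: case_prod_unfold)
  also have "\<dots> = (\<Sum>i\<in>UNIV. \<Sum>k\<in>UNIV. hmult F ra \<sigma> (C i i) (D k k))"
    by (simp add: sum.cartesian_product case_prod_unfold)
  finally show ?thesis
    by (simp add: comod_character_def hmult_sum_left hmult_sum_right) (rule sum.swap)
qed

lemma sum_UNIV_plus:
  "(\<Sum>p\<in>UNIV. h p) = (\<Sum>i\<in>UNIV. h (Inl i)) + (\<Sum>k\<in>UNIV. h (Inr k))"
  for h :: "'i::finite + 'j::finite \<Rightarrow> 'c::comm_monoid_add"
  using sum.Plus[of UNIV UNIV h] by (simp add: comp_def)

lemma comod_sum_simps [simp]:
  "(C \<oplus>\<^sub>c D) (Inl i) (Inl j) = C i j" "(C \<oplus>\<^sub>c D) (Inr k) (Inr l) = D k l"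
  "(C \<oplus>\<^sub>c D) (Inl i) (Inr l) = 0" "(C \<oplus>\<^sub>c D) (Inr k) (Inl j) = 0"
  by (simp_all add: comod_sum_def)

lemma comod_character_sum: "comod_character (C \<oplus>\<^sub>c D) = comod_character C + comod_character D"
  by (simp add: comod_character_def sum_UNIV_plus)

lemma sum_swap_pairs:
  "(\<Sum>m\<in>M. \<Sum>n\<in>N. \<Sum>e\<in>A. \<Sum>e'\<in>B. g m n e e') = (\<Sum>e\<in>A. \<Sum>e'\<in>B. \<Sum>m\<in>M. \<Sum>n\<in>N. g m n e e')"
proof -
  have "(\<Sum>m\<in>M. \<Sum>n\<in>N. \<Sum>e\<in>A. \<Sum>e'\<in>B. g m n e e')
      = (\<Sum>p\<in>M \<times> N. \<Sum>q\<in>A \<times> B. g (fst p) (snd p) (fst q) (snd q))"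
    by (simp add: sum.cartesian_product' case_prod_unfold)
  also have "\<dots> = (\<Sum>q\<in>A \<times> B. \<Sum>p\<in>M \<times> N. g (fst p) (snd p) (fst q) (snd q))"
    by (rule sum.swap)
  finally show ?thesis
    by (simp add: sum.cartesian_product' case_prod_unfold)
qed

lemma hcarrier_zero [simp]: "0 \<in> hcarrier F G"
  by (simp add: hcarrier_def)

lemma hcounit_zero [simp]: "hcounit G 0 = 0"
  by (simp add: hcounit_def)

context bicrossed_data
begin

lemma right_comodule_sum:
  assumes C: "right_comodule F G la \<tau> C" and D: "right_comodule F G la \<tau> D"
  shows "right_comodule F G la \<tau> (C \<oplus>\<^sub>c D)"
proof (rule right_comoduleI)
  note CD = C[unfolded right_comodule_def] D[unfolded right_comodule_def]
  show "(C \<oplus>\<^sub>c D) p q \<in> hcarrier F G" for p q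
    by (cases p; cases q) (simp_all add: CD)
  show "hcounit G ((C \<oplus>\<^sub>c D) p q) = (if p = q then 1 else 0)" for p q
    by (cases p; cases q) (simp_all add: CD)
  show "(\<Sum>r\<in>UNIV. Poly_Mapping.lookup ((C \<oplus>\<^sub>c D) p r) (a, f') * Poly_Mapping.lookup ((C \<oplus>\<^sub>c D) r q) (b, f))
      = (if f' = la b f then \<tau> a b f * Poly_Mapping.lookup ((C \<oplus>\<^sub>c D) p q) (a \<otimes>\<^bsub>G\<^esub> b, f) else 0)"
    if "a \<in> carrier G" "b \<in> carrier G" for p q a b f f'
    by (cases p; cases q)
      (simp_all add: sum_UNIV_plus comodule_coeff_product[OF C that] comodule_coeff_product[OF D that])
qed

text \<open>
  Coassociativity is checked on coefficients. In the product of two coefficients of the tensor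
  product, the coassociativity of \<open>C\<close> and \<open>D\<close> leaves only the degrees
  \<open>e = b \<triangleright> f\<close> and \<open>e' = (b \<triangleleft> f) \<triangleright> f'\<close>, for which \<open>e e' = b \<triangleright> (f f')\<close>; the scalars that remain are
  the right-hand side of the compatibility of \<open>\<sigma>\<close> and \<open>\<tau>\<close>.
\<close>
lemma right_comodule_tensor:
  fixes C :: "('i::finite, 'a, 'b, 'k) coaction" and D :: "('j::finite, 'a, 'b, 'k) coaction"
  assumes C: "right_comodule F G la \<tau> C" and D: "right_comodule F G la \<tau> D"
  shows "right_comodule F G la \<tau> (comod_tensor F ra \<sigma> C D)"
proof (rule right_comoduleI)
  let ?lk = "Poly_Mapping.lookup"
  let ?T = "comod_tensor F ra \<sigma> C D"
  define A where "A = degrees C"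
  define B where "B = degrees D"
  have AB: "finite A" "finite B" "A \<subseteq> carrier F" "B \<subseteq> carrier F"
    using degrees_closed C D by (simp_all add: A_def B_def finite_degrees)
  have lkT: "?lk (?T (i, k) (j, l)) (a, h) = (\<Sum>f\<in>X. \<Sum>f'\<in>Y. if f \<otimes>\<^bsub>F\<^esub> f' = h
        then \<sigma> a f f' * ?lk (C i j) (a, f) * ?lk (D k l) (ra a f, f') else 0)"
    if "finite X" "finite Y" "A \<subseteq> X" "B \<subseteq> Y" for i j k l a h X Y
    unfolding comod_tensor_def prod.case
    using that keys_subset_degrees[of C i j] keys_subset_degrees[of D k l]
    by (intro lookup_hmult) (auto simp: A_def B_def)
  show "?T p q \<in> hcarrier F G" for p q
    using C D by (cases p; cases q) (auto simp: comod_tensor_def right_comodule_def intro: hmult_closed)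
  show "hcounit G (?T p q) = (if p = q then 1 else 0)" for p q
  proof (cases p; cases q)
    fix i k j l assume pq: "p = (i, k)" "q = (j, l)"
    define H where "H = (\<lambda>(f, f'). f \<otimes>\<^bsub>F\<^esub> f') ` (A \<times> B)"
    have fH: "finite H" by (simp add: H_def AB)
    have mH: "f \<otimes>\<^bsub>F\<^esub> f' \<in> H" if "f \<in> A" "f' \<in> B" for f f'
      using that by (auto simp: H_def)
    have suppH: "snd ` Poly_Mapping.keys (?T p q) \<subseteq> H"
      using keys_subset_degrees[of C i j] keys_subset_degrees[of D k l]
      by (auto simp: pq comod_tensor_def A_def B_def elim!: keys_hmultE intro!: mH)
        (auto simp: image_subset_iff)
    have "hcounit G (?T p q) = (\<Sum>h\<in>H. ?lk (?T p q) (\<one>\<^bsub>G\<^esub>, h))"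
      by (rule hcounit_eq[OF fH suppH])
    also have "\<dots> = (\<Sum>h\<in>H. \<Sum>f\<in>A. \<Sum>f'\<in>B. if h = f \<otimes>\<^bsub>F\<^esub> f'
        then ?lk (C i j) (\<one>\<^bsub>G\<^esub>, f) * ?lk (D k l) (\<one>\<^bsub>G\<^esub>, f') else 0)"
      unfolding pq lkT[OF AB(1,2) order_refl order_refl]
      using AB(3,4) by (intro sum.cong refl) (auto simp: subset_iff)
    also have "\<dots> = (\<Sum>f\<in>A. \<Sum>f'\<in>B. \<Sum>h\<in>H. if h = f \<otimes>\<^bsub>F\<^esub> f'
        then ?lk (C i j) (\<one>\<^bsub>G\<^esub>, f) * ?lk (D k l) (\<one>\<^bsub>G\<^esub>, f') else 0)"
      by (subst sum.swap, rule sum.cong[OF refl], rule sum.swap)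
    also have "\<dots> = (\<Sum>f\<in>A. ?lk (C i j) (\<one>\<^bsub>G\<^esub>, f)) * (\<Sum>f'\<in>B. ?lk (D k l) (\<one>\<^bsub>G\<^esub>, f'))"
      unfolding sum_product by (intro sum.cong refl) (simp add: fH mH)
    also have "\<dots> = (if p = q then 1 else 0)"
      unfolding pq comodule_counit[OF C AB(1) A_def[THEN equalityD2]]
        comodule_counit[OF D AB(2) B_def[THEN equalityD2]] by simp
    finally show ?thesis .
  qed
  fix p q :: "'i \<times> 'j" and a b h h'
  assume ab: "a \<in> carrier G" "b \<in> carrier G" and hh: "h \<in> carrier F" "h' \<in> carrier F"
  obtain i k j l where pq: "p = (i, k)" "q = (j, l)" by (metis prod.exhaust)
  \<comment> \<open>The outer degrees range over sets large enough to contain the two surviving ones.\<close>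
  define A' where "A' = A \<union> la b ` A"
  define B' where "B' = B \<union> (\<lambda>(f, f'). la (ra b f) f') ` (A \<times> B)"
  have AB': "finite A'" "finite B'" "A \<subseteq> A'" "B \<subseteq> B'"
    by (simp_all add: A'_def B'_def AB)
  define \<Theta> where "\<Theta> e e' f f' = (if e \<otimes>\<^bsub>F\<^esub> e' = h' \<and> f \<otimes>\<^bsub>F\<^esub> f' = h then \<sigma> a e e' * \<sigma> b f f' else 0)" for e e' f f'
  have "(\<Sum>r\<in>UNIV. ?lk (?T p r) (a, h') * ?lk (?T r q) (b, h))
      = (\<Sum>m\<in>UNIV. \<Sum>n\<in>UNIV. ?lk (?T (i, k) (m, n)) (a, h') * ?lk (?T (m, n) (j, l)) (b, h))"
    unfolding pq sum.cartesian_product UNIV_Times_UNIV by (simp add: case_prod_unfold)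
  also have "\<dots> = (\<Sum>m\<in>UNIV. \<Sum>n\<in>UNIV. \<Sum>f\<in>A. \<Sum>f'\<in>B. \<Sum>e\<in>A'. \<Sum>e'\<in>B'. \<Theta> e e' f f' *
        ((?lk (C i m) (a, e) * ?lk (C m j) (b, f)) *
         (?lk (D k n) (ra a e, e') * ?lk (D n l) (ra b f, f'))))"
    unfolding lkT[of A' B' _ _ _ _ a, OF AB'] lkT[of A B _ _ _ _ b, OF AB(1,2) order_refl order_refl]
    unfolding sum_distrib_left sum_distrib_right
    by (intro sum.cong refl) (auto simp: \<Theta>_def)
  also have "\<dots> = (\<Sum>f\<in>A. \<Sum>f'\<in>B. \<Sum>e\<in>A'. \<Sum>e'\<in>B'. \<Sum>m\<in>UNIV. \<Sum>n\<in>UNIV. \<Theta> e e' f f' *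
        ((?lk (C i m) (a, e) * ?lk (C m j) (b, f)) *
         (?lk (D k n) (ra a e, e') * ?lk (D n l) (ra b f, f'))))"
    (is "(\<Sum>m\<in>UNIV. \<Sum>n\<in>UNIV. \<Sum>f\<in>A. \<Sum>f'\<in>B. \<Sum>e\<in>A'. \<Sum>e'\<in>B'. ?X m n e e' f f') = _")
  proof -
    have "(\<Sum>m\<in>UNIV. \<Sum>n\<in>UNIV. \<Sum>f\<in>A. \<Sum>f'\<in>B. \<Sum>e\<in>A'. \<Sum>e'\<in>B'. ?X m n e e' f f')
      = (\<Sum>f\<in>A. \<Sum>f'\<in>B. \<Sum>m\<in>UNIV. \<Sum>n\<in>UNIV. \<Sum>e\<in>A'. \<Sum>e'\<in>B'. ?X m n e e' f f')"
      by (rule sum_swap_pairs)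
    also have "\<dots> = (\<Sum>f\<in>A. \<Sum>f'\<in>B. \<Sum>e\<in>A'. \<Sum>e'\<in>B'. \<Sum>m\<in>UNIV. \<Sum>n\<in>UNIV. ?X m n e e' f f')"
      by (rule sum.cong[OF refl], rule sum.cong[OF refl], rule sum_swap_pairs)
    finally show ?thesis .
  qed
  also have "\<dots> = (\<Sum>f\<in>A. \<Sum>f'\<in>B. \<Sum>e\<in>A'. \<Sum>e'\<in>B'. \<Theta> e e' f f' *
        ((\<Sum>m\<in>UNIV. ?lk (C i m) (a, e) * ?lk (C m j) (b, f)) *
         (\<Sum>n\<in>UNIV. ?lk (D k n) (ra a e, e') * ?lk (D n l) (ra b f, f'))))"
    unfolding sum_product unfolding sum_distrib_left by (rule refl)
  also have "\<dots> = (\<Sum>f\<in>A. \<Sum>f'\<in>B. if f \<otimes>\<^bsub>F\<^esub> f' = h then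
        (if h' = la b h then \<tau> a b h else 0) *
        (\<sigma> (a \<otimes>\<^bsub>G\<^esub> b) f f' * ?lk (C i j) (a \<otimes>\<^bsub>G\<^esub> b, f) * ?lk (D k l) (ra (a \<otimes>\<^bsub>G\<^esub> b) f, f')) else 0)"
  proof (intro sum.cong refl)
    fix f f' assume ff: "f \<in> A" "f' \<in> B"
    then have F: "f \<in> carrier F" "f' \<in> carrier F" using AB by auto
    let ?e = "la b f" and ?e' = "la (ra b f) f'"
    have inA': "?e \<in> A'" and inB': "?e' \<in> B'" using ff by (auto simp: A'_def B'_def)
    have mult: "?e \<otimes>\<^bsub>F\<^esub> ?e' = la b (f \<otimes>\<^bsub>F\<^esub> f')" using la_mult ab F by simp
    have "(\<Sum>e\<in>A'. \<Sum>e'\<in>B'. \<Theta> e e' f f' *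
        ((\<Sum>m\<in>UNIV. ?lk (C i m) (a, e) * ?lk (C m j) (b, f)) *
         (\<Sum>n\<in>UNIV. ?lk (D k n) (ra a e, e') * ?lk (D n l) (ra b f, f'))))
      = (\<Sum>e\<in>A'. if e = ?e then \<Sum>e'\<in>B'. if e' = ?e' then \<Theta> ?e ?e' f f' *
         (\<tau> a b f * ?lk (C i j) (a \<otimes>\<^bsub>G\<^esub> b, f) *
          (\<tau> (ra a ?e) (ra b f) f' * ?lk (D k l) (ra (a \<otimes>\<^bsub>G\<^esub> b) f, f'))) else 0 else 0)"
      unfolding comodule_coeff_product[OF C ab]
      by (intro sum.cong refl)
        (auto simp: comodule_coeff_product[OF D] ab F ra_Gmult intro!: sum.cong)
    also have "\<dots> = \<Theta> ?e ?e' f f' *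
         (\<tau> a b f * ?lk (C i j) (a \<otimes>\<^bsub>G\<^esub> b, f) *
          (\<tau> (ra a ?e) (ra b f) f' * ?lk (D k l) (ra (a \<otimes>\<^bsub>G\<^esub> b) f, f')))"
      by (simp add: AB' inA' inB')
    also have "\<dots> = (if f \<otimes>\<^bsub>F\<^esub> f' = h then
        (if h' = la b h then \<tau> a b h else 0) *
        (\<sigma> (a \<otimes>\<^bsub>G\<^esub> b) f f' * ?lk (C i j) (a \<otimes>\<^bsub>G\<^esub> b, f) * ?lk (D k l) (ra (a \<otimes>\<^bsub>G\<^esub> b) f, f')) else 0)"
    proof (cases "f \<otimes>\<^bsub>F\<^esub> f' = h \<and> h' = la b h")
      case True
      have "\<sigma> a ?e ?e' * \<sigma> b f f' * \<tau> a b f * \<tau> (ra a ?e) (ra b f) f' = \<sigma> (a \<otimes>\<^bsub>G\<^esub> b) f f' * \<tau> a b h"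
        using \<sigma>_\<tau>_compatible[OF ab F] True by simp
      then show ?thesis
        using True by (simp add: \<Theta>_def mult mult_ac)
    next
      case False
      then show ?thesis by (auto simp: \<Theta>_def mult)
    qed
    finally show "(\<Sum>e\<in>A'. \<Sum>e'\<in>B'. \<Theta> e e' f f' *
        ((\<Sum>m\<in>UNIV. ?lk (C i m) (a, e) * ?lk (C m j) (b, f)) *
         (\<Sum>n\<in>UNIV. ?lk (D k n) (ra a e, e') * ?lk (D n l) (ra b f, f')))) = \<dots>" .
  qed
  also have "\<dots> = (if h' = la b h then \<tau> a b h * ?lk (?T p q) (a \<otimes>\<^bsub>G\<^esub> b, h) else 0)"
    unfolding pq lkT[OF AB(1,2) order_refl order_refl]
    by (auto simp: sum_distrib_left intro!: sum.cong sum.neutral)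
  finally show "(\<Sum>r\<in>UNIV. ?lk (?T p r) (a, h') * ?lk (?T r q) (b, h))
      = (if h' = la b h then \<tau> a b h * ?lk (?T p q) (a \<otimes>\<^bsub>G\<^esub> b, h) else 0)" .
qed

end

section \<open>Characters classify comodules over the two-element group\<close>

context bicrossed_data
begin

lemma coeff_mat_one_mult:
  assumes C: "right_comodule F G la \<tau> C" and "a \<in> carrier G" "f \<in> carrier F"
  shows "coeff_mat C \<one>\<^bsub>G\<^esub> h ** coeff_mat C a f = (if h = la a f then coeff_mat C a f else 0)"
    and "coeff_mat C a h ** coeff_mat C \<one>\<^bsub>G\<^esub> f = (if h = f then coeff_mat C a f else 0)"
  using assms by (simp_all add: coeff_mat_mult[OF C])

text \<open>
  Equivalences between components of equal degree, compatible with the action of \<open>G\<close>, add up to an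
  isomorphism: components of different degrees are orthogonal, and the degree idempotents sum
  to \<open>1\<close>.
\<close>
lemma comod_iso_gradedI:
  fixes C :: "('i::finite, 'a, 'b, 'k) coaction" and D :: "('j::finite, 'a, 'b, 'k) coaction"
  assumes C: "right_comodule F G la \<tau> C" and D: "right_comodule F G la \<tau> D"
    and YZ: "\<And>f. f \<in> carrier F \<Longrightarrow>
      mat_equiv (coeff_mat C \<one>\<^bsub>G\<^esub> f) (coeff_mat D \<one>\<^bsub>G\<^esub> f) (Y f) (Z f)"
    and inter: "\<And>a f. a \<in> carrier G \<Longrightarrow> f \<in> carrier F \<Longrightarrow>
      Y (la a f) ** coeff_mat C a f = coeff_mat D a f ** Y f"
  shows "C \<cong>\<^sub>c D"
proof -
  define A where "A = degrees C \<union> degrees D"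
  have A: "finite A" "A \<subseteq> carrier F" "degrees C \<subseteq> A" "degrees D \<subseteq> A"
    using degrees_closed[OF C] degrees_closed[OF D] by (auto simp: A_def finite_degrees)
  let ?C = "coeff_mat C" and ?D = "coeff_mat D"
  define P where "P = (\<Sum>f\<in>A. Y f)"
  define Q where "Q = (\<Sum>f\<in>A. Z f)"
  have orth: "?C \<one>\<^bsub>G\<^esub> h ** ?C \<one>\<^bsub>G\<^esub> f = (if h = f then ?C \<one>\<^bsub>G\<^esub> f else 0)"
    "?D \<one>\<^bsub>G\<^esub> h ** ?D \<one>\<^bsub>G\<^esub> f = (if h = f then ?D \<one>\<^bsub>G\<^esub> f else 0)" if "f \<in> carrier F" for f h
    using that by (simp_all add: coeff_mat_one_mult[OF C] coeff_mat_one_mult[OF D])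
  have cross: "Y h ** Z f = (if h = f then ?D \<one>\<^bsub>G\<^esub> f else 0)"
    "Z h ** Y f = (if h = f then ?C \<one>\<^bsub>G\<^esub> f else 0)" if "f \<in> A" "h \<in> A" for f h
  proof -
    have F: "f \<in> carrier F" "h \<in> carrier F" using that A by auto
    show "Y h ** Z f = (if h = f then ?D \<one>\<^bsub>G\<^esub> f else 0)"
      using YZ[OF F(1)] mat_equiv_orthogonal(6)[OF YZ[OF F(2)] YZ[OF F(1)]] orth[OF F(1), of h]
      by (auto simp: mat_equiv_def)
    show "Z h ** Y f = (if h = f then ?C \<one>\<^bsub>G\<^esub> f else 0)"
      using YZ[OF F(1)] mat_equiv_orthogonal(5)[OF YZ[OF F(2)] YZ[OF F(1)]] orth[OF F(1), of h]
      by (auto simp: mat_equiv_def)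
  qed
  have "P ** Q = mat 1"
    by (simp add: P_def Q_def matrix_mult_sum_left matrix_mult_sum_right cross A(1)
        sum_coeff_mat_one[OF D A(1,4)])
  moreover have "Q ** P = mat 1"
    by (simp add: P_def Q_def matrix_mult_sum_left matrix_mult_sum_right cross A(1)
        sum_coeff_mat_one[OF C A(1,3)])
  ultimately have "invertible P" unfolding invertible_def by blast
  moreover have "P ** ?C a f = ?D a f ** P" for a f
  proof (cases "a \<in> carrier G \<and> f \<in> A")
    case False
    then have "?C a f = 0" "?D a f = 0"
      using coeff_mat_outside[OF C] coeff_mat_outside[OF D] coeff_mat_eq_0[of f C] coeff_mat_eq_0[of f D] A
      by blast+
    then show ?thesis by simp
  next
    case True
    then have a: "a \<in> carrier G" and f: "f \<in> A" "f \<in> carrier F" using A by auto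
    have YC: "Y h ** ?C a f = (if h = la a f then Y h ** ?C a f else 0)" if "h \<in> A" for h
    proof -
      have "h \<in> carrier F" using that A by auto
      then have "Y h ** ?C a f = Y h ** (?C \<one>\<^bsub>G\<^esub> h ** ?C a f)"
        using YZ[of h] by (simp add: mat_equiv_def matrix_mul_assoc)
      then show ?thesis by (simp add: coeff_mat_one_mult[OF C a f(2)])
    qed
    have DY: "?D a f ** Y h = (if h = f then ?D a f ** Y h else 0)" if "h \<in> A" for h
    proof -
      have h: "h \<in> carrier F" using that A by auto
      then have "?D a f ** Y h = (?D a f ** ?D \<one>\<^bsub>G\<^esub> h) ** Y h"
        using YZ[of h] by (simp add: mat_equiv_def matrix_mul_assoc[symmetric])
      then show ?thesis by (simp add: coeff_mat_one_mult[OF D a h])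
    qed
    have "?C a f = 0" if "la a f \<notin> A"
    proof -
      have "?C \<one>\<^bsub>G\<^esub> (la a f) = 0" using coeff_mat_eq_0[of "la a f" C] that A by blast
      then show ?thesis using coeff_mat_one_mult(1)[OF C a f(2), of "la a f"] by simp
    qed
    then have "P ** ?C a f = Y (la a f) ** ?C a f"
      unfolding P_def matrix_mult_sum_left by (subst sum.cong[OF refl YC]) (auto simp: A(1))
    moreover have "?D a f ** P = ?D a f ** Y f"
      unfolding P_def matrix_mult_sum_right using f by (subst sum.cong[OF refl DY]) (auto simp: A(1))
    ultimately show ?thesis using inter[OF a f(2)] by simp
  qed
  ultimately show ?thesis unfolding comod_iso_iff_coeff_mat by blast
qed

end

locale bicrossed_data_Z2 = bicrossed_data F G ra la \<sigma> \<tau>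
  for F :: "('b, 'n) monoid_scheme" and G :: "('a, 'm) monoid_scheme"
    and ra :: "'a \<Rightarrow> 'b \<Rightarrow> 'a" and la :: "'a \<Rightarrow> 'b \<Rightarrow> 'b"
    and \<sigma> :: "'a \<Rightarrow> 'b \<Rightarrow> 'b \<Rightarrow> 'k::field" and \<tau> :: "'a \<Rightarrow> 'a \<Rightarrow> 'b \<Rightarrow> 'k" +
  fixes g
  assumes carrier_G: "carrier G = {\<one>\<^bsub>G\<^esub>, g}" and g_not_one: "g \<noteq> \<one>\<^bsub>G\<^esub>"
begin

lemma g_in [simp]: "g \<in> carrier G" by (simp add: carrier_G)

lemma gg [simp]: "g \<otimes>\<^bsub>G\<^esub> g = \<one>\<^bsub>G\<^esub>"
  using G.m_closed[of g g] g_not_one G.l_cancel_one[of g g] by (auto simp: carrier_G)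

lemma la_g_la_g [simp]: "f \<in> carrier F \<Longrightarrow> la g (la g f) = f"
  by (simp add: la_la)

text \<open>
  Each \<open>f\<close> permutes the two elements of \<open>G\<close> and fixes \<open>1\<close>.
\<close>
lemma ra_g [simp]: assumes "f \<in> carrier F" shows "ra g f = g"
proof (rule ccontr)
  assume "ra g f \<noteq> g"
  then have "ra g f = \<one>\<^bsub>G\<^esub>" using ra_closed[of g f] assms by (auto simp: carrier_G)
  then have "ra g (f \<otimes>\<^bsub>F\<^esub> inv\<^bsub>F\<^esub> f) = \<one>\<^bsub>G\<^esub>"
    using ra_mult[of g f "inv\<^bsub>F\<^esub> f"] assms by (simp del: F.r_inv)
  then show False using assms g_not_one ra_one[of g] by simp
qed

lemma la_g_mult: "f \<in> carrier F \<Longrightarrow> f' \<in> carrier F \<Longrightarrow> la g (f \<otimes>\<^bsub>F\<^esub> f') = la g f \<otimes>\<^bsub>F\<^esub> la g f'"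
  by (simp add: la_mult)

lemma \<tau>_gg_invariant: "f \<in> carrier F \<Longrightarrow> \<tau> g g (la g f) = \<tau> g g f"
  using \<tau>_cocycle[of g g g f] by simp

end

locale bicrossed_data_Z2_char_0 = bicrossed_data_Z2 F G ra la \<sigma> \<tau> g
  for F :: "('b, 'n) monoid_scheme" and G :: "('a, 'm) monoid_scheme"
    and ra :: "'a \<Rightarrow> 'b \<Rightarrow> 'a" and la :: "'a \<Rightarrow> 'b \<Rightarrow> 'b"
    and \<sigma> :: "'a \<Rightarrow> 'b \<Rightarrow> 'b \<Rightarrow> 'k::field_char_0" and \<tau> :: "'a \<Rightarrow> 'a \<Rightarrow> 'b \<Rightarrow> 'k" and g
begin

text \<open>
  In a degree moved by \<open>g\<close> only the dimensions have to agree. In a fixed degree, dividing the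
  action of \<open>g\<close> by a square root \<open>r\<close> of \<open>\<tau> g g f\<close> turns it into an involution of the component, and
  the equivalence has to respect it.
\<close>
lemma component_equiv:
  fixes C :: "('i::finite, 'a, 'b, 'k) coaction" and D :: "('j::finite, 'a, 'b, 'k) coaction"
  assumes C: "right_comodule F G la \<tau> C" and D: "right_comodule F G la \<tau> D"
    and chars: "comod_character C = comod_character D"
    and f: "f \<in> carrier F"
    and sqrt: "la g f = f \<Longrightarrow> r ^ 2 = \<tau> g g f"
  shows "\<exists>Y Z. mat_equiv (coeff_mat C \<one>\<^bsub>G\<^esub> f) (coeff_mat D \<one>\<^bsub>G\<^esub> f) Y Z \<and>
    (la g f = f \<longrightarrow> Y ** coeff_mat C g f = coeff_mat D g f ** Y)"
proof -
  let ?C = "coeff_mat C" and ?D = "coeff_mat D"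
  have idem: "?C \<one>\<^bsub>G\<^esub> f ** ?C \<one>\<^bsub>G\<^esub> f = ?C \<one>\<^bsub>G\<^esub> f" "?D \<one>\<^bsub>G\<^esub> f ** ?D \<one>\<^bsub>G\<^esub> f = ?D \<one>\<^bsub>G\<^esub> f"
    using f by (simp_all add: coeff_mat_one_mult[OF C] coeff_mat_one_mult[OF D])
  have tr: "trace (?C a f) = trace (?D a f)" for a
    by (simp add: trace_coeff_mat chars)
  show ?thesis
  proof (cases "la g f = f")
    case False
    then show ?thesis
      using idempotents_equal_trace_equivalent[OF idem tr] by metis
  next
    case True
    note r2 = sqrt[OF True]
    have r0: "r \<noteq> 0" using r2 \<tau>_nonzero[of g g f] f by auto
    have rr: "inverse r * (inverse r * \<tau> g g f) = 1"
      using r0 by (simp add: r2[symmetric] power2_eq_square field_simps)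
    have CN: "?C \<one>\<^bsub>G\<^esub> f ** ?C g f = ?C g f" "?C g f ** ?C \<one>\<^bsub>G\<^esub> f = ?C g f"
      "?C g f ** ?C g f = mscale (\<tau> g g f) (?C \<one>\<^bsub>G\<^esub> f)"
      using f True by (simp_all add: coeff_mat_one_mult[OF C] coeff_mat_mult[OF C])
    have DN: "?D \<one>\<^bsub>G\<^esub> f ** ?D g f = ?D g f" "?D g f ** ?D \<one>\<^bsub>G\<^esub> f = ?D g f"
      "?D g f ** ?D g f = mscale (\<tau> g g f) (?D \<one>\<^bsub>G\<^esub> f)"
      using f True by (simp_all add: coeff_mat_one_mult[OF D] coeff_mat_mult[OF D])
    obtain Y Z where YZ: "mat_equiv (?C \<one>\<^bsub>G\<^esub> f) (?D \<one>\<^bsub>G\<^esub> f) Y Z"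
      and comm: "Y ** mscale (inverse r) (?C g f) = mscale (inverse r) (?D g f) ** Y"
      using involutions_equal_trace_equivalent[of "?C \<one>\<^bsub>G\<^esub> f" "mscale (inverse r) (?C g f)"
          "?D \<one>\<^bsub>G\<^esub> f" "mscale (inverse r) (?D g f)"]
      by (auto simp: idem tr CN DN trace_mscale mscale_mult_left mscale_mult_right mscale_mscale rr mult.assoc)
    have "mscale r (Y ** mscale (inverse r) (?C g f)) = mscale r (mscale (inverse r) (?D g f) ** Y)"
      by (simp add: comm)
    then have "Y ** ?C g f = ?D g f ** Y"
      using r0 by (simp add: mscale_mult_left mscale_mult_right mscale_mscale)
    then show ?thesis using YZ by blast
  qed
qed

text \<open>
  The equivalences of single components need not commute with the action of \<open>g\<close> between the two
  members of an orbit \<open>{f, g \<triangleright> f}\<close>. Therefore the one at a chosen representative of the orbit is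
  kept, and the other one is obtained from it by conjugating with the action of \<open>g\<close>.
\<close>
theorem comod_iso_if_same_character:
  fixes C :: "('i::finite, 'a, 'b, 'k) coaction" and D :: "('j::finite, 'a, 'b, 'k) coaction"
  assumes C: "right_comodule F G la \<tau> C" and D: "right_comodule F G la \<tau> D"
    and chars: "comod_character C = comod_character D"
    and sqrt: "\<And>f. f \<in> carrier F \<Longrightarrow> la g f = f \<Longrightarrow> rt f ^ 2 = \<tau> g g f"
  shows "C \<cong>\<^sub>c D"
proof -
  let ?C = "coeff_mat C" and ?D = "coeff_mat D"
  have "\<forall>f\<in>carrier F. \<exists>Y Z. mat_equiv (?C \<one>\<^bsub>G\<^esub> f) (?D \<one>\<^bsub>G\<^esub> f) Y Z \<and>
    (la g f = f \<longrightarrow> Y ** ?C g f = ?D g f ** Y)"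
    using component_equiv[OF C D chars _ sqrt] by blast
  then obtain Y0 Z0 where equiv0: "\<And>f. f \<in> carrier F \<Longrightarrow> mat_equiv (?C \<one>\<^bsub>G\<^esub> f) (?D \<one>\<^bsub>G\<^esub> f) (Y0 f) (Z0 f)"
    and inter0: "\<And>f. f \<in> carrier F \<Longrightarrow> la g f = f \<Longrightarrow> Y0 f ** ?C g f = ?D g f ** Y0 f"
    by metis
  \<comment> \<open>A choice depending only on the set, hence the same for both members of the orbit.\<close>
  define rep where "rep f = (SOME h. h \<in> {f, la g f})" for f
  have rep: "rep f \<in> {f, la g f}" for f
    unfolding rep_def by (rule someI[of _ f]) simp
  have rep_la: "rep (la g f) = rep f" if "f \<in> carrier F" for f
    using that by (simp add: rep_def insert_commute)
  define Y where "Y f = (if rep f = f then Y0 f else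
    mscale (inverse (\<tau> g g f)) (?D g (la g f) ** Y0 (la g f) ** ?C g f))" for f
  define Z where "Z f = (if rep f = f then Z0 f else
    mscale (inverse (\<tau> g g f)) (?C g (la g f) ** Z0 (la g f) ** ?D g f))" for f
  have moved: "mat_equiv (?C \<one>\<^bsub>G\<^esub> f) (?D \<one>\<^bsub>G\<^esub> f) (Y f) (Z f)"
      "Y f ** ?C g (la g f) = ?D g (la g f) ** Y0 (la g f)"
      "?D g f ** Y f = Y0 (la g f) ** ?C g f"
    if f: "f \<in> carrier F" and r: "rep f \<noteq> f" for f
  proof -
    have h: "la g f \<in> carrier F" using f by simp
    have \<tau>0: "inverse (\<tau> g g f) * \<tau> g g f = 1" using \<tau>_nonzero f by simp
    have rules: "coeff_mat X g f ** coeff_mat X g (la g f) = mscale (\<tau> g g f) (coeff_mat X \<one>\<^bsub>G\<^esub> (la g f))"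
        "coeff_mat X g (la g f) ** coeff_mat X g f = mscale (\<tau> g g f) (coeff_mat X \<one>\<^bsub>G\<^esub> f)"
        "coeff_mat X \<one>\<^bsub>G\<^esub> f ** coeff_mat X g (la g f) = coeff_mat X g (la g f)"
        "coeff_mat X g f ** coeff_mat X \<one>\<^bsub>G\<^esub> f = coeff_mat X g f" "coeff_mat X \<one>\<^bsub>G\<^esub> (la g f) ** coeff_mat X g f = coeff_mat X g f"
      if X: "right_comodule F G la \<tau> X" for X :: "('l::finite, 'a, 'b, 'k) coaction"
      using f h by (simp_all add: coeff_mat_mult[OF X] \<tau>_gg_invariant)
    show "mat_equiv (?C \<one>\<^bsub>G\<^esub> f) (?D \<one>\<^bsub>G\<^esub> f) (Y f) (Z f)"
      "Y f ** ?C g (la g f) = ?D g (la g f) ** Y0 (la g f)"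
      "?D g f ** Y f = Y0 (la g f) ** ?C g f"
      using mat_equiv_transport[OF equiv0[OF h] rules[OF C] rules[OF D] \<tau>0] r
      by (simp_all add: Y_def Z_def)
  qed
  show ?thesis
  proof (rule comod_iso_gradedI[OF C D])
    fix f assume f: "f \<in> carrier F"
    show equiv: "mat_equiv (?C \<one>\<^bsub>G\<^esub> f) (?D \<one>\<^bsub>G\<^esub> f) (Y f) (Z f)"
      using moved(1)[OF f] equiv0[OF f] by (cases "rep f = f") (simp_all add: Y_def Z_def)
    fix a assume "a \<in> carrier G"
    then consider "a = \<one>\<^bsub>G\<^esub>" | "a = g" by (auto simp: carrier_G)
    then show "Y (la a f) ** ?C a f = ?D a f ** Y f"
    proof cases
      case 1
      then show ?thesis using equiv f by (simp add: mat_equiv_def)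
    next
      case 2
      show ?thesis
      proof (cases "la g f = f")
        case True
        then have "rep f = f" using rep[of f] by simp
        then show ?thesis using 2 True inter0[OF f] by (simp add: Y_def)
      next
        case False
        show ?thesis
        proof (cases "rep f = f")
          case True
          then have "rep (la g f) \<noteq> la g f" using rep_la[OF f] False by simp
          from moved(2)[OF _ this] True f 2 show ?thesis by (simp add: Y_def)
        next
          case r: False
          then have "rep (la g f) = la g f" using rep_la[OF f] rep[of f] by auto
          with moved(3)[OF f r] 2 show ?thesis by (simp add: Y_def)
        qed
      qed
    qed
  qed
qed

end

section \<open>Products of characters\<close>

context bicrossed_data_Z2
begin

text \<open>
  The characters of the one-dimensional comodules have this form, with \<open>c\<close> a square root of
  \<open>\<tau> g g f\<close>.
\<close>
definition point_char :: "'b \<Rightarrow> 'k \<Rightarrow> ('a, 'b, 'k) hopf" where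
  "point_char f c = hbasis \<one>\<^bsub>G\<^esub> f + smul c (hbasis g f)"

text \<open>
  The character of \<open>W\<close> at a moved \<open>f\<close>; at a fixed \<open>f\<close>, the sum of the characters
  of \<open>U\<close> and \<open>V\<close>.
\<close>
definition orbit_char :: "'b \<Rightarrow> ('a, 'b, 'k) hopf" where
  "orbit_char f = hbasis \<one>\<^bsub>G\<^esub> f + hbasis \<one>\<^bsub>G\<^esub> (la g f)"

lemma point_char_mult:
  assumes "f \<in> carrier F" "f' \<in> carrier F"
  shows "hmult F ra \<sigma> (point_char f c) (point_char f' c')
    = point_char (f \<otimes>\<^bsub>F\<^esub> f') (\<sigma> g f f' * c * c')"
  using assms g_not_one g_not_one[symmetric]
  by (simp add: point_char_def hmult_add_left hmult_add_right hmult_smul_left hmult_smul_right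
      hmult_hbasis smul_smul mult_ac)

lemma point_orbit_char_mult:
  assumes "f \<in> carrier F" "la g f = f" "f' \<in> carrier F"
  shows "hmult F ra \<sigma> (point_char f c) (orbit_char f') = orbit_char (f \<otimes>\<^bsub>F\<^esub> f')"
    and "hmult F ra \<sigma> (orbit_char f') (point_char f c) = orbit_char (f' \<otimes>\<^bsub>F\<^esub> f)"
  using assms g_not_one g_not_one[symmetric]
  by (simp_all add: point_char_def orbit_char_def hmult_add_left hmult_add_right hmult_smul_left
      hmult_smul_right hmult_hbasis la_g_mult)

text \<open>
  Of the four products of basis elements, \<open>(g \<triangleright> f)(g \<triangleright> f')\<close> is the partner of \<open>f f'\<close> in its orbit, and
  \<open>(g \<triangleright> f) f'\<close> is the partner of \<open>f (g \<triangleright> f')\<close>.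
\<close>
lemma orbit_char_mult:
  assumes "f \<in> carrier F" "f' \<in> carrier F"
  shows "hmult F ra \<sigma> (orbit_char f) (orbit_char f')
    = orbit_char (f \<otimes>\<^bsub>F\<^esub> f') + orbit_char (f \<otimes>\<^bsub>F\<^esub> la g f')"
  using assms
  by (simp add: orbit_char_def hmult_add_left hmult_add_right hmult_hbasis la_g_mult add_ac)

lemma point_char_add_opposite: "la g f = f \<Longrightarrow> point_char f c + point_char f (- c) = orbit_char f"
  by (rule poly_mapping_eqI) (simp add: point_char_def orbit_char_def lookup_add)

lemma \<tau>_gg_mult:
  assumes "f \<in> carrier F" "la g f = f" "f' \<in> carrier F" "la g f' = f'"
  shows "\<tau> g g (f \<otimes>\<^bsub>F\<^esub> f') = (\<sigma> g f f')\<^sup>2 * \<tau> g g f * \<tau> g g f'"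
  using \<sigma>_\<tau>_compatible[of g g f f'] assms by (simp add: power2_eq_square)

end

section \<open>The Grothendieck ring\<close>

theorem proposition5p1:
  fixes F :: "('b, 'n) monoid_scheme" and G :: "('a, 'm) monoid_scheme" and g :: 'a
    and ra :: "'a \<Rightarrow> 'b \<Rightarrow> 'a" and la :: "'a \<Rightarrow> 'b \<Rightarrow> 'b"
    and \<sigma> :: "'a \<Rightarrow> 'b \<Rightarrow> 'b \<Rightarrow> 'k::{alg_closed_field, field_char_0}"
    and \<tau> :: "'a \<Rightarrow> 'a \<Rightarrow> 'b \<Rightarrow> 'k"
    and rt :: "'b \<Rightarrow> 'k"
    and U :: "'b \<Rightarrow> ('u::finite, 'a, 'b, 'k) coaction"
    and V :: "'b \<Rightarrow> ('v::finite, 'a, 'b, 'k) coaction"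
    and W :: "'b \<Rightarrow> ('w::finite, 'a, 'b, 'k) coaction"
  defines "S \<equiv> fixed_part F la g" and "T \<equiv> moved_part F la g"
  assumes "matched_pair F G ra la"
    and "carrier G = {\<one>\<^bsub>G\<^esub>, g}" and "g \<noteq> \<one>\<^bsub>G\<^esub>"
    and "compatible_cocycles F G ra la \<sigma> \<tau>"
    and "\<forall>f\<in>S. rt f ^ 2 = \<tau> g g f"
    and "\<forall>f\<in>S. right_comodule F G la \<tau> (U f) \<and>
           comod_character (U f) = hbasis \<one>\<^bsub>G\<^esub> f + smul (rt f) (hbasis g f)"
    and "\<forall>f\<in>S. right_comodule F G la \<tau> (V f) \<and>
           comod_character (V f) = hbasis \<one>\<^bsub>G\<^esub> f - smul (rt f) (hbasis g f)"
    and "\<forall>f\<in>T. right_comodule F G la \<tau> (W f) \<and>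
           comod_character (W f) = hbasis \<one>\<^bsub>G\<^esub> f + hbasis \<one>\<^bsub>G\<^esub> (la g f)"
  shows
    "(\<forall>f\<in>S. \<forall>f'\<in>S.
        if rt (f \<otimes>\<^bsub>F\<^esub> f') = \<sigma> g f f' * rt f * rt f' then
          comod_tensor F ra \<sigma> (U f) (U f') \<cong>\<^sub>c comod_tensor F ra \<sigma> (V f) (V f') \<and>
          comod_tensor F ra \<sigma> (V f) (V f') \<cong>\<^sub>c U (f \<otimes>\<^bsub>F\<^esub> f') \<and>
          comod_tensor F ra \<sigma> (U f) (V f') \<cong>\<^sub>c comod_tensor F ra \<sigma> (V f) (U f') \<and>
          comod_tensor F ra \<sigma> (V f) (U f') \<cong>\<^sub>c V (f \<otimes>\<^bsub>F\<^esub> f')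
        else
          comod_tensor F ra \<sigma> (U f) (U f') \<cong>\<^sub>c comod_tensor F ra \<sigma> (V f) (V f') \<and>
          comod_tensor F ra \<sigma> (V f) (V f') \<cong>\<^sub>c V (f \<otimes>\<^bsub>F\<^esub> f') \<and>
          comod_tensor F ra \<sigma> (U f) (V f') \<cong>\<^sub>c comod_tensor F ra \<sigma> (V f) (U f') \<and>
          comod_tensor F ra \<sigma> (V f) (U f') \<cong>\<^sub>c U (f \<otimes>\<^bsub>F\<^esub> f')) \<and>
     (\<forall>f\<in>S. \<forall>f'\<in>T.
        comod_tensor F ra \<sigma> (U f) (W f') \<cong>\<^sub>c comod_tensor F ra \<sigma> (V f) (W f') \<and>
        comod_tensor F ra \<sigma> (V f) (W f') \<cong>\<^sub>c W (f \<otimes>\<^bsub>F\<^esub> f') \<and>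
        comod_tensor F ra \<sigma> (W f') (U f) \<cong>\<^sub>c comod_tensor F ra \<sigma> (W f') (V f) \<and>
        comod_tensor F ra \<sigma> (W f') (V f) \<cong>\<^sub>c W (f' \<otimes>\<^bsub>F\<^esub> f)) \<and>
     (\<forall>f\<in>T. \<forall>f'\<in>T.
        (f \<otimes>\<^bsub>F\<^esub> f' \<in> T \<and> f \<otimes>\<^bsub>F\<^esub> la g f' \<in> T \<longrightarrow>
           comod_tensor F ra \<sigma> (W f) (W f') \<cong>\<^sub>c
             W (f \<otimes>\<^bsub>F\<^esub> f') \<oplus>\<^sub>c W (f \<otimes>\<^bsub>F\<^esub> la g f')) \<and>
        (f \<otimes>\<^bsub>F\<^esub> f' \<in> S \<and> f \<otimes>\<^bsub>F\<^esub> la g f' \<in> T \<longrightarrow>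
           comod_tensor F ra \<sigma> (W f) (W f') \<cong>\<^sub>c
             U (f \<otimes>\<^bsub>F\<^esub> f') \<oplus>\<^sub>c V (f \<otimes>\<^bsub>F\<^esub> f') \<oplus>\<^sub>c W (f \<otimes>\<^bsub>F\<^esub> la g f')) \<and>
        (f \<otimes>\<^bsub>F\<^esub> f' \<in> T \<and> f \<otimes>\<^bsub>F\<^esub> la g f' \<in> S \<longrightarrow>
           comod_tensor F ra \<sigma> (W f) (W f') \<cong>\<^sub>c
             W (f \<otimes>\<^bsub>F\<^esub> f') \<oplus>\<^sub>c U (f \<otimes>\<^bsub>F\<^esub> la g f') \<oplus>\<^sub>c V (f \<otimes>\<^bsub>F\<^esub> la g f')) \<and>
        (f \<otimes>\<^bsub>F\<^esub> f' \<in> S \<and> f \<otimes>\<^bsub>F\<^esub> la g f' \<in> S \<longrightarrow>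
           comod_tensor F ra \<sigma> (W f) (W f') \<cong>\<^sub>c
             U (f \<otimes>\<^bsub>F\<^esub> f') \<oplus>\<^sub>c V (f \<otimes>\<^bsub>F\<^esub> f') \<oplus>\<^sub>c
             U (f \<otimes>\<^bsub>F\<^esub> la g f') \<oplus>\<^sub>c V (f \<otimes>\<^bsub>F\<^esub> la g f')))"
proof -
  interpret H: bicrossed_data_Z2_char_0 F G ra la \<sigma> \<tau> g
    using assms(3-6) by unfold_locales auto
  let ?T = "\<lambda>C D. comod_tensor F ra \<sigma> C D"
  have S: "f \<in> S \<longleftrightarrow> f \<in> carrier F \<and> la g f = f" and T: "f \<in> T \<longleftrightarrow> f \<in> carrier F \<and> la g f \<noteq> f" for f
    by (auto simp: S_def T_def fixed_part_def moved_part_def)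
  have U: "right_comodule F G la \<tau> (U f)" "comod_character (U f) = hbasis \<one>\<^bsub>G\<^esub> f + smul (rt f) (hbasis g f)"
    and V: "right_comodule F G la \<tau> (V f)" "comod_character (V f) = hbasis \<one>\<^bsub>G\<^esub> f - smul (rt f) (hbasis g f)"
    and rt: "rt f ^ 2 = \<tau> g g f"
    if "f \<in> S" for f
    using assms(7-9) that by auto
  have W: "right_comodule F G la \<tau> (W f)" "comod_character (W f) = hbasis \<one>\<^bsub>G\<^esub> f + hbasis \<one>\<^bsub>G\<^esub> (la g f)"
    if "f \<in> T" for f
    using assms(10) that by auto
  have iso: "C \<cong>\<^sub>c D" if "right_comodule F G la \<tau> C" "right_comodule F G la \<tau> D"
      "comod_character C = comod_character D"
    for C :: "('x::finite, 'a, 'b, 'k) coaction" and D :: "('y::finite, 'a, 'b, 'k) coaction"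
    by (rule H.comod_iso_if_same_character[OF that, of rt]) (simp add: rt S)
  note comod = H.right_comodule_tensor H.right_comodule_sum U(1) V(1) W(1)
  have smul_minus: "hbasis \<one>\<^bsub>G\<^esub> f - smul c (hbasis g f) = H.point_char f (- c)" for f c
    by (rule poly_mapping_eqI) (simp add: H.point_char_def lookup_add lookup_minus)
  have \<chi>: "f \<in> S \<Longrightarrow> comod_character (U f) = H.point_char f (rt f)"
    "f \<in> S \<Longrightarrow> comod_character (V f) = H.point_char f (- rt f)"
    "f \<in> T \<Longrightarrow> comod_character (W f) = H.orbit_char f" for f
    using U(2) V(2) W(2) by (simp_all add: smul_minus) (simp_all add: H.point_char_def H.orbit_char_def)
  have \<chi>UV: "comod_character (U f) + (comod_character (V f) + x) = H.orbit_char f + x"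
    "comod_character (U f) + comod_character (V f) = H.orbit_char f" if "f \<in> S" for f x
    using that H.point_char_add_opposite[of f "rt f"] by (simp_all add: \<chi> S add.assoc[symmetric])
  have SS: "f \<otimes>\<^bsub>F\<^esub> f' \<in> S" if "f \<in> S" "f' \<in> S" for f f'
    using that by (simp add: S H.la_g_mult)
  have ST: "f \<otimes>\<^bsub>F\<^esub> f' \<in> T" "f' \<otimes>\<^bsub>F\<^esub> f \<in> T" if "f \<in> S" "f' \<in> T" for f f'
    using that by (simp_all add: S T H.la_g_mult)
  \<comment> \<open>Both sides square to the value of \<open>\<tau> g g\<close> at the product, so they agree up to a sign.\<close>
  have sign: "rt (f \<otimes>\<^bsub>F\<^esub> f') = \<sigma> g f f' * rt f * rt f' \<or> rt (f \<otimes>\<^bsub>F\<^esub> f') = - (\<sigma> g f f' * rt f * rt f')"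
    if "f \<in> S" "f' \<in> S" for f f'
  proof -
    have "(rt (f \<otimes>\<^bsub>F\<^esub> f'))\<^sup>2 = (\<sigma> g f f' * rt f * rt f')\<^sup>2"
      using that SS[OF that] H.\<tau>_gg_mult[of f f'] by (simp add: rt S power_mult_distrib)
    then show ?thesis by (simp add: power2_eq_iff)
  qed
  have part1: "if rt (f \<otimes>\<^bsub>F\<^esub> f') = \<sigma> g f f' * rt f * rt f' then
          ?T (U f) (U f') \<cong>\<^sub>c ?T (V f) (V f') \<and> ?T (V f) (V f') \<cong>\<^sub>c U (f \<otimes>\<^bsub>F\<^esub> f') \<and>
          ?T (U f) (V f') \<cong>\<^sub>c ?T (V f) (U f') \<and> ?T (V f) (U f') \<cong>\<^sub>c V (f \<otimes>\<^bsub>F\<^esub> f')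
        else
          ?T (U f) (U f') \<cong>\<^sub>c ?T (V f) (V f') \<and> ?T (V f) (V f') \<cong>\<^sub>c V (f \<otimes>\<^bsub>F\<^esub> f') \<and>
          ?T (U f) (V f') \<cong>\<^sub>c ?T (V f) (U f') \<and> ?T (V f) (U f') \<cong>\<^sub>c U (f \<otimes>\<^bsub>F\<^esub> f')"
    if f: "f \<in> S" "f' \<in> S" for f f'
    using sign[OF f] f SS[OF f]
    by (auto intro!: iso comod simp: comod_character_tensor \<chi> H.point_char_mult S)
  have part2: "?T (U f) (W f') \<cong>\<^sub>c ?T (V f) (W f')" "?T (V f) (W f') \<cong>\<^sub>c W (f \<otimes>\<^bsub>F\<^esub> f')"
      "?T (W f') (U f) \<cong>\<^sub>c ?T (W f') (V f)" "?T (W f') (V f) \<cong>\<^sub>c W (f' \<otimes>\<^bsub>F\<^esub> f)"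
    if f: "f \<in> S" "f' \<in> T" for f f'
  proof -
    note \<chi>' = comod_character_tensor \<chi>(1,2)[OF f(1)] \<chi>(3)[OF f(2)] ST[OF f, THEN \<chi>(3)]
    have "f \<in> carrier F" "la g f = f" "f' \<in> carrier F" using f by (simp_all add: S T)
    note mult = H.point_orbit_char_mult[OF this]
    show "?T (U f) (W f') \<cong>\<^sub>c ?T (V f) (W f')" "?T (V f) (W f') \<cong>\<^sub>c W (f \<otimes>\<^bsub>F\<^esub> f')"
      "?T (W f') (U f) \<cong>\<^sub>c ?T (W f') (V f)" "?T (W f') (V f) \<cong>\<^sub>c W (f' \<otimes>\<^bsub>F\<^esub> f)"
      by (intro iso comod f ST; simp add: \<chi>' mult)+
  qed
  have part3: "?T (W f) (W f') \<cong>\<^sub>c M"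
    if f: "f \<in> T" "f' \<in> T" and M: "right_comodule F G la \<tau> M"
      "comod_character M = H.orbit_char (f \<otimes>\<^bsub>F\<^esub> f') + H.orbit_char (f \<otimes>\<^bsub>F\<^esub> la g f')"
    for f f' and M :: "('x::finite, 'a, 'b, 'k) coaction"
    using f by (intro iso comod M(1)) (simp_all add: comod_character_tensor \<chi> M(2) T H.orbit_char_mult)
  show ?thesis
    by (intro conjI ballI impI; (elim conjE)?; rule part1 part2 part3;
      simp add: comod comod_character_sum \<chi>UV \<chi>(3))
qed

end
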